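(* Let $G$ be a finite trivalent graph with a perfect matching $M$, let $PK_G(\lambda)=\sum_{S}(-1)^{n(S)}2^{n(S)}\lambda^{c(S)}$ be its Penrose-Kauffman polynomial (sum over all states $S$ of $(G,M)$), and write $PK_G(q)$ for this polynomial after the substitution $\lambda=1+q$. Let $H^{k,j}(G)$ be the Penrose-Kauffman homology groups of $(G,M)$. Then $$PK_{G}(q) = \sum_{j} q^{j}\, \chi(H^{\star, j}(G)),$$ where $\chi(H^{\star,j}(G))=\sum_k(-1)^k\operatorname{rank}H^{k,j}(G)$.
   Context: A perfect matching $M$ of $G$ is a set of pairwise disjoint edges whose end nodes comprise all nodes of $G$. At each matching edge, let $a,b$ denote the two other edge-ends at one of its end nodes, and $c,d$ the two other edge-ends at the other end node. The matching edge (a "site") can be replaced by: parallel arcs (joining $a$ to $c$ and $b$ to $d$); crossed arcs (joining $a$ to $d$ and $b$ to $c$, crossing transversely without a node); or a nodal crossing (crossed arcs with a bullet node at the crossing, so that $a,b,c,d$ are all joined together). Which of the two pairings is called parallel is a fixed choice at each matching edge (determined by a drawing of $G$). States: a state $S$ of $(G,M)$ is a configuration obtained by replacing every matching edge by parallel arcs, crossed arcs, or a nodal crossing. $n(S)$ is the number of nodal crossings of $S$. The loops of $S$ are the closed paths obtained by walking along the arcs of $S$, going transversely straight through every crossing; two loops that meet at a nodal crossing belong to the same component, and $c(S)$ is the number of components of $S$ under the equivalence relation this generates. The polynomial $PK_G(\lambda)=\sum_S(-1)^{n(S)}2^{n(S)}\lambda^{c(S)}$ corresponds to the expansion at each matching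 edge: [matching edge] = [parallel arcs] + [crossed arcs] $-\,2$[nodal crossing], with $k$ disjoint (or overlapping without nodes) loops evaluated as $\lambda^k$. Enhanced states: an enhanced state $s$ is a state $S$ together with a label $0$ or $1$ on each nodal crossing and a label $1$ or $x$ on each component of $S$, component labels being regarded as elements of $\mathbb{Z}[x]/(x^2)$. $n(s)$ is the number of nodal crossings, $j(s)$ the number of components labeled $x$. Complex: $C^{k,j}$ is the free abelian group on enhanced states with $k$ nodal crossings and $j(s)=j$. For an enhanced state $s$ and a site of $s$ that is not a nodal crossing, the partial differential replaces parallel arcs at that site by a nodal crossing labeled $0$, or crossed arcs at that site by a nodal crossing labeled $1$; if this joins two different components with labels $a,b$, the resulting component gets label $ab\in\mathbb{Z}[x]/(x^2)$ (the result being $0$ if $ab=0$); if the two arcs at the site are in a single component, that component keeps its label; all other labels are kept. Fix an ordering of the matching edges (sites). The differential $d(s)$ is the sum over all non-nodal sites of the partial differentials with sign $(-1)^{\pi}$, where $\pi$ is the number of non-nodal sites of $s$ preceding the site being operated on. Then $d:C^{k,j}\to C^{k+1,j}$, $d^2=0$, and $H^{k,j}(G)$ denotes the kernel of $d$ on $C^{k,j}$ modulo the image of $d$ from $C^{k-1,j}$. *)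

theory Defs
  imports
    "HOL-Algebra.Free_Abelian_Groups"
    "HOL-Computational_Algebra.Polynomial"
    "HOL-Library.Groups_Big_Fun"
    "Graph_Theory.Bidirected_Digraph"
begin

section \<open>Trivalent graphs with a perfect matching\<close>

text \<open>
  An undirected multigraph (loops and multiple edges allowed) is a bidirected digraph: an arc
  \<open>a\<close> is an edge-end sitting at the node \<open>tail G a\<close>, the other end of the same edge is
  \<open>arev a\<close>, and the edge itself is the set \<open>{a, arev a}\<close>.
\<close>

definition edges :: "('a, 'b) pre_digraph \<Rightarrow> ('b \<Rightarrow> 'b) \<Rightarrow> 'b set set" where
  "edges G arev = {{a, arev a} |a. a \<in> arcs G}"

definition end_nodes :: "('a, 'b) pre_digraph \<Rightarrow> 'b set \<Rightarrow> 'a set" where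
  "end_nodes G e = tail G ` e"

text \<open>The cardinality condition says that a loop is not a matching edge.\<close>

definition perfect_matching ::
  "('a, 'b) pre_digraph \<Rightarrow> ('b \<Rightarrow> 'b) \<Rightarrow> 'b set set \<Rightarrow> bool" where
  "perfect_matching G arev M \<longleftrightarrow>
     M \<subseteq> edges G arev \<and>
     (\<forall>e\<in>M. card (end_nodes G e) = 2) \<and>
     pairwise (\<lambda>e e'. disjnt (end_nodes G e) (end_nodes G e')) M \<and>
     (\<Union>e\<in>M. end_nodes G e) = verts G"

text \<open>
  The map \<open>par\<close> records the pairing called parallel: it exchanges the two non-matching edge-ends
  \<open>a, b\<close> at one end node of each matching edge with the two non-matching edge-ends \<open>c, d\<close> at
  the other end node. The order \<open>r\<close> of the matching edges only enters the signs of the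
  differential.
\<close>

locale matched_trivalent_graph =
  fin_digraph G + bidirected_digraph G arev
  for G :: "('a, 'b) pre_digraph" and arev :: "'b \<Rightarrow> 'b" +
  fixes M :: "'b set set" and par :: "'b \<Rightarrow> 'b" and r :: "'b set rel"
  assumes trivalent: "\<And>v. v \<in> verts G \<Longrightarrow> out_degree G v = 3"
    and matching: "perfect_matching G arev M"
    and par_end: "\<And>a. a \<in> arcs G - \<Union>M \<Longrightarrow> par a \<in> arcs G - \<Union>M"
    and par_par: "\<And>a. a \<in> arcs G - \<Union>M \<Longrightarrow> par (par a) = a"
    and par_across:
      "\<And>a. a \<in> arcs G - \<Union>M \<Longrightarrow> \<exists>e\<in>M. end_nodes G e = {tail G a, tail G (par a)}"
    and site_order: "linear_order_on M r"


section \<open>States, loops and components\<close>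

datatype resolution = Parallel | Crossed | Nodal

context matched_trivalent_graph
begin

definition free_ends :: "'b set" where
  "free_ends = arcs G - \<Union>M"

definition legs :: "'b set \<Rightarrow> 'b set" where
  "legs e = {a \<in> free_ends. tail G a \<in> end_nodes G e}"

definition site_of :: "'b \<Rightarrow> 'b set" where
  "site_of a = (THE e. e \<in> M \<and> a \<in> legs e)"

definition crs :: "'b \<Rightarrow> 'b" where
  "crs a = (THE c. c \<in> free_ends \<and> tail G c = tail G (par a) \<and> c \<noteq> par a)"

definition states :: "('b set \<Rightarrow> resolution) set" where
  "states = M \<rightarrow>\<^sub>E UNIV"

definition nodal_sites :: "('b set \<Rightarrow> resolution) \<Rightarrow> 'b set set" where
  "nodal_sites S = {e \<in> M. S e = Nodal}"

definition num_nodal :: "('b set \<Rightarrow> resolution) \<Rightarrow> nat" where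
  "num_nodal S = card (nodal_sites S)"

text \<open>A walk goes straight through a nodal crossing, i.e. along the crossed arcs.\<close>

definition arc_end :: "('b set \<Rightarrow> resolution) \<Rightarrow> 'b \<Rightarrow> 'b" where
  "arc_end S a = (if S (site_of a) = Parallel then par a else crs a)"

definition walk_step :: "('b set \<Rightarrow> resolution) \<Rightarrow> 'b rel" where
  "walk_step S = {(a, b). a \<in> free_ends \<and> (b = arev a \<or> b = arc_end S a)}"

text \<open>A loop is represented by the set of edge-ends it traverses.\<close>

definition loops :: "('b set \<Rightarrow> resolution) \<Rightarrow> 'b set set" where
  "loops S = free_ends // (walk_step S)\<^sup>*"

definition loops_meet :: "('b set \<Rightarrow> resolution) \<Rightarrow> 'b set rel" where
  "loops_meet S = {(L, L'). L \<in> loops S \<and> L' \<in> loops S \<and>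
     (\<exists>e\<in>nodal_sites S. L \<inter> legs e \<noteq> {} \<and> L' \<inter> legs e \<noteq> {})}"

text \<open>
  Components are classes of loops, each represented by the union of its loops; so every component
  is a set of edge-ends and can be compared between different states.
\<close>

definition components :: "('b set \<Rightarrow> resolution) \<Rightarrow> 'b set set" where
  "components S = Union ` (loops S // (loops_meet S)\<^sup>*)"

definition num_components :: "('b set \<Rightarrow> resolution) \<Rightarrow> nat" where
  "num_components S = card (components S)"

definition PK :: "int poly" where
  "PK = (\<Sum>S\<in>states. monom ((- 1) ^ num_nodal S * 2 ^ num_nodal S) (num_components S))"

end


section \<open>Enhanced states\<close>

text \<open>
  Elements of \<open>\<int>[x]/(x\<^sup>2)\<close> are represented by integer polynomials of degree at most one;
  \<open>poly_cutoff 2\<close> reduces modulo \<open>x\<^sup>2\<close>.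
\<close>

abbreviation label_x :: "int poly" where
  "label_x \<equiv> [:0, 1:]"

type_synonym 'b enhanced_state =
  "('b set \<Rightarrow> resolution) \<times> ('b set \<Rightarrow> nat) \<times> ('b set \<Rightarrow> int poly)"

context matched_trivalent_graph
begin

definition enhanced_states :: "'b enhanced_state set" where
  "enhanced_states = {(S, u, m). S \<in> states \<and> u \<in> nodal_sites S \<rightarrow>\<^sub>E {0, 1} \<and>
     m \<in> components S \<rightarrow>\<^sub>E {1, label_x}}"

definition hom_degree :: "'b enhanced_state \<Rightarrow> nat" where
  "hom_degree = (\<lambda>(S, u, m). num_nodal S)"

definition x_degree :: "'b enhanced_state \<Rightarrow> nat" where
  "x_degree = (\<lambda>(S, u, m). card {K \<in> components S. m K = label_x})"


section \<open>The Penrose-Kauffman complex and its homology\<close>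

text \<open>
  The components through a non-nodal site are one or two in number. The product of their labels
  is the label of the component through the new nodal crossing: the old label in the first case,
  \<open>ab\<close> in the second.
\<close>

definition joined_label ::
  "('b set \<Rightarrow> resolution) \<Rightarrow> ('b set \<Rightarrow> int poly) \<Rightarrow> 'b set \<Rightarrow> int poly" where
  "joined_label S m e = poly_cutoff 2 (\<Prod>K\<in>{K \<in> components S. K \<inter> legs e \<noteq> {}}. m K)"

definition partial_diff :: "'b set \<Rightarrow> 'b enhanced_state \<Rightarrow> 'b enhanced_state \<Rightarrow>\<^sub>0 int" where
  "partial_diff e = (\<lambda>(S, u, m).
     let S' = S(e := Nodal);
         u' = u(e := (if S e = Parallel then 0 else 1));
         p = joined_label S m e;
         m' = restrict (\<lambda>K. if K \<inter> legs e = {} then m K else p) (components S')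
     in if p = 0 then 0 else frag_of (S', u', m'))"

definition preceding_sites :: "'b set \<Rightarrow> 'b enhanced_state \<Rightarrow> 'b set set" where
  "preceding_sites e = (\<lambda>(S, u, m). {e' \<in> M - nodal_sites S. e' \<noteq> e \<and> (e', e) \<in> r})"

definition diff :: "('b enhanced_state \<Rightarrow>\<^sub>0 int) \<Rightarrow> ('b enhanced_state \<Rightarrow>\<^sub>0 int)" where
  "diff = frag_extend (\<lambda>s. \<Sum>e\<in>M - nodal_sites (fst s).
     frag_cmul ((- 1) ^ card (preceding_sites e s)) (partial_diff e s))"

definition chain_grp :: "nat \<Rightarrow> nat \<Rightarrow> ('b enhanced_state \<Rightarrow>\<^sub>0 int) monoid" where
  "chain_grp k j =
     free_Abelian_group {s \<in> enhanced_states. hom_degree s = k \<and> x_degree s = j}"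

definition cycles :: "nat \<Rightarrow> nat \<Rightarrow> ('b enhanced_state \<Rightarrow>\<^sub>0 int) set" where
  "cycles k j = kernel (chain_grp k j) (chain_grp (Suc k) j) diff"

definition boundaries :: "nat \<Rightarrow> nat \<Rightarrow> ('b enhanced_state \<Rightarrow>\<^sub>0 int) set" where
  "boundaries k j = (case k of 0 \<Rightarrow> {0} | Suc i \<Rightarrow> diff ` carrier (chain_grp i j))"

definition homology_grp :: "nat \<Rightarrow> nat \<Rightarrow> ('b enhanced_state \<Rightarrow>\<^sub>0 int) set monoid" where
  "homology_grp k j = subgroup_generated (chain_grp k j) (cycles k j) Mod boundaries k j"

end


section \<open>Rank and Euler characteristic\<close>

definition int_independent :: "('c, 'd) monoid_scheme \<Rightarrow> 'c set \<Rightarrow> bool" where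
  "int_independent A B \<longleftrightarrow> finite B \<and> B \<subseteq> carrier A \<and>
     (\<forall>c::'c \<Rightarrow> int.
        (\<Otimes>\<^bsub>A\<^esub>b\<in>B. b [^]\<^bsub>A\<^esub> c b) = \<one>\<^bsub>A\<^esub> \<longrightarrow> (\<forall>b\<in>B. c b = 0))"

text \<open>The supremum is the intended one for abelian groups of finite rank, in particular for
  finitely generated ones.\<close>

definition abelian_rank :: "('c, 'd) monoid_scheme \<Rightarrow> nat" where
  "abelian_rank A = Sup (card ` {B. int_independent A B})"

text \<open>\<open>Sum_any\<close> is the sum of a family of finite support.\<close>

definition (in matched_trivalent_graph) euler_char :: "nat \<Rightarrow> int" where
  "euler_char j = Sum_any (\<lambda>k. (- 1) ^ k * int (abelian_rank (homology_grp k j)))"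

end

theory Submission
  imports Defs "HOL-Library.Function_Algebras"
begin

text \<open>
  Both sides equal the sum of \<open>(-1)\<^sup>n q\<^sup>j\<close> over all enhanced states, where \<open>n\<close> is the number of nodal
  crossings and \<open>j\<close> the number of labels \<open>x\<close>. For the polynomial this is an expansion of
  \<open>2\<^sup>n (1 + q)\<^sup>c\<close> over the labels of the crossings and of the components (\<open>PK_enhanced_states\<close>). For the
  homology it is the Euler-Poincare principle, applied to the finite complex with fixed \<open>j\<close>
  (\<open>euler_char_eq\<close>, \<open>euler_polynomial\<close>).
  
  The principle requires a complex. The components of a state are the classes of an equivalence
  relation on the edge-ends that do not belong to matching edges (\<open>components_eq\<close>); making a site nodal
  adds to it the square of the set of edge-ends at the site (\<open>contact_update\<close>). A partial differential
  therefore coarsens the partition into components, and it multiplies the labels of the components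
  that are merged. Multiplication modulo \<open>x\<^sup>2\<close> is functorial under coarsening, so two partial
  differentials commute (\<open>partial_diff_commute\<close>), and a nonzero product keeps the number of factors \<open>x\<close>,
  so \<open>j\<close> is preserved (\<open>partial_diff_cases\<close>). The signs anticommute, and the differential squares to
  zero (\<open>diff_diff\<close>).
  
  For the ranks, chains are embedded into a rational vector space. The largest integrally independent
  subset of a quotient \<open>X / Y\<close> has as many elements as the difference of the dimensions of the spans of
  \<open>X\<close> and \<open>Y\<close> (\<open>abelian_rank_quotient\<close>), and the same count applied to the kernel gives rank-nullity
  (\<open>frag_rank_kernel_image\<close>). In the alternating sum the ranks of the boundaries cancel
  (\<open>alternating_rank_homology\<close>).
\<close>

section \<open>Rank of a quotient of subgroups of a free abelian group\<close>

text \<open>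
  An element of a free abelian group on a type is viewed as a rational-valued function on the
  generators. Linear algebra over the rationals then measures subgroups.
\<close>

definition rational_frag :: "('e \<Rightarrow>\<^sub>0 int) \<Rightarrow> 'e \<Rightarrow> rat" where
  "rational_frag x = (\<lambda>s. of_int (Poly_Mapping.lookup x s))"

interpretation rat_fun: vector_space "\<lambda>(q::rat) (f::'e \<Rightarrow> rat) s. q * f s"
  by unfold_locales (auto simp: algebra_simps fun_eq_iff)

text \<open>
  The rank of a set of elements of a free abelian group: the dimension of its rational span.
\<close>

definition frag_rank :: "('e \<Rightarrow>\<^sub>0 int) set \<Rightarrow> nat" where
  "frag_rank X = rat_fun.dim (rational_frag ` X)"

text \<open>
  Linear independence over the integers modulo a subgroup \<open>Y\<close>, for finite sets only.
\<close>

definition independent_mod :: "('e \<Rightarrow>\<^sub>0 int) set \<Rightarrow> ('e \<Rightarrow>\<^sub>0 int) set \<Rightarrow> bool" where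
  "independent_mod Y D \<longleftrightarrow> finite D \<and>
     (\<forall>c. (\<Sum>d\<in>D. frag_cmul (c d) d) \<in> Y \<longrightarrow> (\<forall>d\<in>D. c d = 0))"

lemma inj_rational_frag: "inj rational_frag"
  by (auto simp: inj_on_def rational_frag_def fun_eq_iff intro: poly_mapping_eqI)

lemma rational_frag_0 [simp]: "rational_frag 0 = 0"
  by (auto simp: rational_frag_def)

lemma rational_frag_eq_0_iff [simp]: "rational_frag x = 0 \<longleftrightarrow> x = 0"
  using injD[OF inj_rational_frag, of x 0] by auto

lemma rational_frag_cmul: "rational_frag (frag_cmul k x) = (\<lambda>s. of_int k * rational_frag x s)"
  by (auto simp: rational_frag_def)

lemma rational_frag_add: "rational_frag (x + y) = rational_frag x + rational_frag y"
  by (auto simp: rational_frag_def lookup_add)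

lemma rational_frag_sum:
  "rational_frag (\<Sum>d\<in>D. frag_cmul (c d) d) = (\<Sum>d\<in>D. (\<lambda>s. of_int (c d) * rational_frag d s))"
  by (induction D rule: infinite_finite_induct)
     (auto simp: rational_frag_add rational_frag_cmul)

lemma common_denominator:
  fixes q :: "'a \<Rightarrow> rat"
  assumes "finite A"
  obtains N :: int and c :: "'a \<Rightarrow> int"
  where "N \<noteq> 0" "\<And>a. a \<in> A \<Longrightarrow> of_int N * q a = of_int (c a)"
proof -
  have "\<exists>N::int. N \<noteq> 0 \<and> (\<forall>a\<in>A. of_int N * q a \<in> \<int>)"
    using assms
  proof (induction A)
    case empty
    show ?case by (intro exI[of _ 1]) auto
  next
    case (insert a A)
    then obtain N :: int where N: "N \<noteq> 0" "\<And>a. a \<in> A \<Longrightarrow> of_int N * q a \<in> \<int>"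
      by blast
    obtain n d :: int where nd: "d > 0" "q a = of_int n / of_int d"
      by (metis Fract_of_int_quotient Rat_cases)
    show ?case
    proof (intro exI[of _ "d * N"] conjI ballI)
      fix b assume b: "b \<in> insert a A"
      show "of_int (d * N) * q b \<in> \<int>"
      proof (cases "b = a")
        case True
        have "of_int (d * N) * q b = of_int (N * n)"
          using nd True by simp
        then show ?thesis by (metis Ints_of_int)
      next
        case False
        then have "of_int d * (of_int N * q b) \<in> \<int>"
          using b N(2)[of b] Ints_mult[OF Ints_of_int] by blast
        then show ?thesis by (simp only: of_int_mult mult.assoc)
      qed
    qed (use nd N in auto)
  qed
  then obtain N :: int where N: "N \<noteq> 0" "\<forall>a\<in>A. of_int N * q a \<in> \<int>"
    by blast
  from N(2) have "\<forall>a\<in>A. \<exists>k::int. of_int N * q a = of_int k"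
    by (metis Ints_cases)
  then obtain c :: "'a \<Rightarrow> int" where "\<forall>a\<in>A. of_int N * q a = of_int (c a)"
    by metis
  with N that show ?thesis by blast
qed

text \<open>
  Clearing denominators turns a rational relation into an integral one, so independence over the
  integers and over the rationals agree.
\<close>

lemma independent_rational_frag_iff:
  assumes "finite D"
  shows "\<not> rat_fun.dependent (rational_frag ` D) \<longleftrightarrow> independent_mod {0} D"
proof
  assume ind: "\<not> rat_fun.dependent (rational_frag ` D)"
  show "independent_mod {0} D"
    unfolding independent_mod_def
  proof (intro conjI allI impI ballI)
    fix c d assume c: "(\<Sum>d\<in>D. frag_cmul (c d) d) \<in> {0}" and d: "d \<in> D"
    have "(\<Sum>v\<in>rational_frag ` D. (\<lambda>s. of_int (c (inv_into UNIV rational_frag v)) * v s)) =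
          (\<Sum>d\<in>D. (\<lambda>s. of_int (c d) * rational_frag d s))"
      by (subst sum.reindex)
         (auto simp: inv_f_f[OF inj_rational_frag] intro: inj_on_subset[OF inj_rational_frag])
    also have "\<dots> = 0"
      using c by (simp flip: rational_frag_sum)
    finally have "(of_int (c (inv_into UNIV rational_frag (rational_frag d))) :: rat) = 0"
      using rat_fun.independentD[OF ind, of "rational_frag ` D"
          "\<lambda>v. of_int (c (inv_into UNIV rational_frag v))" "rational_frag d"] assms d by auto
    then show "c d = 0"
      by (simp add: inv_f_f[OF inj_rational_frag])
  qed (use assms in auto)
next
  assume ind: "independent_mod {0} D"
  show "\<not> rat_fun.dependent (rational_frag ` D)"
  proof (rule rat_fun.independent_if_scalars_zero)
    fix q v assume q: "(\<Sum>v\<in>rational_frag ` D. (\<lambda>s. q v * v s)) = 0"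
      and "v \<in> rational_frag ` D"
    then obtain d where d: "d \<in> D" "v = rational_frag d" by blast
    obtain N c where N: "N \<noteq> 0"
      and c: "\<And>d. d \<in> D \<Longrightarrow> of_int N * q (rational_frag d) = of_int (c d)"
      using common_denominator[OF assms, of "q \<circ> rational_frag"] by auto
    have q': "(\<Sum>d\<in>D. (\<lambda>s. q (rational_frag d) * rational_frag d s)) = 0"
      using q by (simp only: sum.reindex[OF inj_on_subset[OF inj_rational_frag subset_UNIV]] o_def)
    have "rational_frag (\<Sum>d\<in>D. frag_cmul (c d) d) =
        (\<Sum>d\<in>D. (\<lambda>s. of_int (c d) * rational_frag d s))"
      by (rule rational_frag_sum)
    also have "\<dots> = (\<Sum>d\<in>D. (\<lambda>s. of_int N * (q (rational_frag d) * rational_frag d s)))"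
      by (intro sum.cong) (simp_all only: c mult.assoc[symmetric])
    also have "\<dots> = (\<lambda>s. of_int N * (\<Sum>d\<in>D. (\<lambda>s. q (rational_frag d) * rational_frag d s)) s)"
      by (rule rat_fun.scale_sum_right[symmetric])
    also have "\<dots> = (\<lambda>s. of_int N * (0 :: 'a \<Rightarrow> rat) s)"
      unfolding q' ..
    also have "\<dots> = 0" by (rule ext) simp
    finally have "(\<Sum>d\<in>D. frag_cmul (c d) d) = 0" by simp
    with ind d have "c d = 0" by (auto simp: independent_mod_def)
    with c[OF d(1)] N d show "q v = 0" by simp
  qed (use assms in auto)
qed

text \<open>
  A subgroup is taken inside the free abelian group on the whole type; a support condition is stated
  separately where one is needed.
\<close>

abbreviation frag_subgroup :: "('e \<Rightarrow>\<^sub>0 int) set \<Rightarrow> bool" where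
  "frag_subgroup X \<equiv> subgroup X (free_Abelian_group UNIV)"

lemma frag_subgroup_0: "frag_subgroup X \<Longrightarrow> 0 \<in> X"
  using subgroup.one_closed by force

lemma frag_subgroup_add: "frag_subgroup X \<Longrightarrow> x \<in> X \<Longrightarrow> y \<in> X \<Longrightarrow> x + y \<in> X"
  using subgroup.m_closed by force

lemma frag_subgroup_minus: "frag_subgroup X \<Longrightarrow> x \<in> X \<Longrightarrow> - x \<in> X"
  using subgroup.m_inv_closed by force

lemma frag_subgroup_diff: "frag_subgroup X \<Longrightarrow> x \<in> X \<Longrightarrow> y \<in> X \<Longrightarrow> x - y \<in> X"
  using frag_subgroup_add[OF _ _ frag_subgroup_minus] by force

lemma frag_subgroup_cmul: "frag_subgroup X \<Longrightarrow> x \<in> X \<Longrightarrow> frag_cmul k x \<in> X"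
  by (rule frag_closure_minus_cmul) (auto intro: frag_subgroup_0 frag_subgroup_diff)

lemma frag_subgroup_sum:
  "frag_subgroup X \<Longrightarrow> (\<And>i. i \<in> I \<Longrightarrow> f i \<in> X) \<Longrightarrow> sum f I \<in> X"
  by (induction I rule: infinite_finite_induct) (auto intro: frag_subgroup_0 frag_subgroup_add)

lemma frag_subgroupI:
  assumes "0 \<in> X" "\<And>x y. x \<in> X \<Longrightarrow> y \<in> X \<Longrightarrow> x - y \<in> X"
  shows "frag_subgroup X"
proof -
  have neg: "- x \<in> X" if "x \<in> X" for x
    using assms(2)[OF assms(1) that] by simp
  moreover have "x + y \<in> X" if "x \<in> X" "y \<in> X" for x y
    using assms(2)[OF that(1) neg[OF that(2)]] by simp
  ultimately show ?thesis
    using assms(1) by (intro group.subgroupI[OF group_free_Abelian_group]) auto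
qed

lemma rational_frag_finite_basis:
  assumes "finite S" "\<And>x. x \<in> X \<Longrightarrow> Poly_Mapping.keys x \<subseteq> S"
  shows "rational_frag ` X \<subseteq> rat_fun.span (rational_frag ` frag_of ` S)"
proof
  fix v assume "v \<in> rational_frag ` X"
  then obtain x where x: "x \<in> X" "v = rational_frag x" by blast
  have "x = (\<Sum>s\<in>S. frag_cmul (Poly_Mapping.lookup x s) (frag_of s))"
    by (subst frag_expansion, unfold frag_extend_def, rule sum.mono_neutral_left)
       (use assms x in \<open>auto simp: in_keys_iff\<close>)
  also have "rational_frag \<dots> =
     (\<Sum>d\<in>frag_of ` S. (\<lambda>s. of_int (Poly_Mapping.lookup x (inv_into UNIV frag_of d)) * rational_frag d s))"
  proof -
    have i: "inj (frag_of :: 'a \<Rightarrow> _)" by (auto simp: inj_on_def frag_of_eq)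
    have "(\<Sum>s\<in>S. frag_cmul (Poly_Mapping.lookup x s) (frag_of s)) =
       (\<Sum>d\<in>frag_of ` S. frag_cmul (Poly_Mapping.lookup x (inv_into UNIV frag_of d)) d)"
      by (subst sum.reindex) (auto simp: inv_f_f[OF i] intro: inj_on_subset[OF i])
    then show ?thesis by (simp only: rational_frag_sum)
  qed
  also have "\<dots> \<in> rat_fun.span (rational_frag ` frag_of ` S)"
    by (intro rat_fun.span_sum rat_fun.span_scale rat_fun.span_base) auto
  finally show "v \<in> rat_fun.span (rational_frag ` frag_of ` S)"
    using x by simp
qed

lemma frag_rank_free:
  assumes "finite S"
  shows "frag_rank {x. Poly_Mapping.keys x \<subseteq> S} = card S"
proof -
  have i: "inj_on (frag_of :: 'a \<Rightarrow> _) S" by (auto simp: inj_on_def frag_of_eq)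
  have "independent_mod {0} (frag_of ` S)"
    unfolding independent_mod_def
  proof (intro conjI allI impI ballI)
    fix c :: "('a \<Rightarrow>\<^sub>0 int) \<Rightarrow> int" and d
    assume c: "(\<Sum>d\<in>frag_of ` S. frag_cmul (c d) d) \<in> {0}" and "d \<in> frag_of ` S"
    then obtain t where t: "t \<in> S" "d = frag_of t" by blast
    have "(\<Sum>s\<in>S. frag_cmul (c (frag_of s)) (frag_of s)) = 0"
      using c by (simp add: sum.reindex[OF i])
    then have "Poly_Mapping.lookup (\<Sum>s\<in>S. frag_cmul (c (frag_of s)) (frag_of s)) t = 0"
      by simp
    then show "c d = 0"
      using assms t by (simp add: lookup_sum if_distrib sum.delta' cong: if_cong)
  qed (use assms in auto)
  then have "\<not> rat_fun.dependent (rational_frag ` frag_of ` S)"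
    using assms by (subst independent_rational_frag_iff) auto
  moreover have "rational_frag ` {x. Poly_Mapping.keys x \<subseteq> S} \<subseteq> rat_fun.span (rational_frag ` frag_of ` S)"
    using assms by (intro rational_frag_finite_basis) auto
  moreover have "card (rational_frag ` frag_of ` S) = card S"
    using i by (simp add: card_image inj_on_subset[OF inj_rational_frag])
  ultimately show ?thesis
    unfolding frag_rank_def by (intro rat_fun.dim_unique) auto
qed

text \<open>
  Together with the next lemma: the largest size of a subset of \<open>X\<close> that is independent modulo \<open>Y\<close>
  is the difference of the ranks. Here, a set independent modulo \<open>Y\<close> and a basis of the span of \<open>Y\<close>
  are disjoint and jointly independent.
\<close>

lemma independent_mod_card_le:
  assumes X: "frag_subgroup X" and Y: "frag_subgroup Y" and sub: "Y \<subseteq> X"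
    and S: "finite S" "\<And>x. x \<in> X \<Longrightarrow> Poly_Mapping.keys x \<subseteq> S"
    and D: "D \<subseteq> X" "independent_mod Y D"
  shows "card D + frag_rank Y \<le> frag_rank X"
proof -
  obtain BY where BY: "BY \<subseteq> rational_frag ` Y" "\<not> rat_fun.dependent BY"
      "card BY = rat_fun.dim (rational_frag ` Y)"
    by (metis rat_fun.basis_exists)
  obtain E where E: "E \<subseteq> Y" "BY = rational_frag ` E"
    using BY(1) by (meson subset_imageE)
  have fin: "finite T" if "T \<subseteq> rational_frag ` X" "\<not> rat_fun.dependent T" for T
    using rat_fun.independent_span_bound[of "rational_frag ` frag_of ` S" T]
      rational_frag_finite_basis[of S X] S that by blast
  have finD: "finite D" using D(2) by (simp add: independent_mod_def)
  have "finite BY" using BY sub by (intro fin) auto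
  then have finE: "finite E"
    using E by (metis finite_imageD inj_on_subset[OF inj_rational_frag] subset_UNIV)
  have indE: "independent_mod {0} E"
    using BY(2) E(2) independent_rational_frag_iff[OF finE] by simp
  have disj: "D \<inter> E = {}"
  proof (rule ccontr)
    assume "D \<inter> E \<noteq> {}"
    then obtain d where d: "d \<in> D" "d \<in> Y" using E by blast
    have "(\<Sum>x\<in>D. frag_cmul (if x = d then 1 else 0) x) = (\<Sum>x\<in>D. if x = d then d else 0)"
      by (intro sum.cong) auto
    also have "\<dots> = d" using d finD by simp
    finally have "(\<Sum>x\<in>D. frag_cmul (if x = d then 1 else 0) x) \<in> Y"
      using d by simp
    then have "\<forall>x\<in>D. (if x = d then 1 else 0::int) = 0"
      using D(2) unfolding independent_mod_def by (elim conjE allE impE)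
    with d show False by auto
  qed
  have "independent_mod {0} (D \<union> E)"
    unfolding independent_mod_def
  proof (intro conjI allI impI)
    fix c assume "(\<Sum>d\<in>D \<union> E. frag_cmul (c d) d) \<in> {0}"
    then have s: "(\<Sum>d\<in>D. frag_cmul (c d) d) + (\<Sum>d\<in>E. frag_cmul (c d) d) = 0"
      using finD finE disj by (simp add: sum.union_disjoint)
    have "(\<Sum>d\<in>E. frag_cmul (c d) d) \<in> Y"
      using E Y by (intro frag_subgroup_sum frag_subgroup_cmul) auto
    moreover have "(\<Sum>d\<in>D. frag_cmul (c d) d) = - (\<Sum>d\<in>E. frag_cmul (c d) d)"
      using s by (simp only: eq_neg_iff_add_eq_0)
    ultimately have "(\<Sum>d\<in>D. frag_cmul (c d) d) \<in> Y"
      using frag_subgroup_minus[OF Y] by simp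
    then have c: "\<forall>d\<in>D. c d = 0" using D(2) by (simp add: independent_mod_def)
    with s have "(\<Sum>d\<in>E. frag_cmul (c d) d) = 0" by simp
    then have "\<forall>d\<in>E. c d = 0" using indE by (simp add: independent_mod_def)
    with c show "\<forall>d\<in>D \<union> E. c d = 0" by blast
  qed (use finD finE in auto)
  then have ind: "\<not> rat_fun.dependent (rational_frag ` (D \<union> E))"
    using finD finE by (subst independent_rational_frag_iff) auto
  obtain BX where BX: "BX \<subseteq> rational_frag ` X" "\<not> rat_fun.dependent BX"
      "rational_frag ` X \<subseteq> rat_fun.span BX" "card BX = rat_fun.dim (rational_frag ` X)"
    by (metis rat_fun.basis_exists)
  have "card (rational_frag ` (D \<union> E)) \<le> card BX"
    using rat_fun.independent_span_bound[OF fin[OF BX(1,2)] ind] BX(3) D(1) E(1) sub by blast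
  moreover have "card (rational_frag ` (D \<union> E)) = card D + card E"
    using finD finE disj
    by (simp add: card_image[OF inj_on_subset[OF inj_rational_frag]] card_Un_disjoint)
  moreover have "card E = card BY"
    using E(2) by (simp add: card_image[OF inj_on_subset[OF inj_rational_frag]])
  ultimately show ?thesis
    unfolding frag_rank_def using BX(4) BY(3) by simp
qed

text \<open>
  A basis of the span of \<open>Y\<close> is extended, by elements of \<open>X\<close>, to a basis of the span of \<open>X\<close>; the
  added elements are independent modulo \<open>Y\<close>.
\<close>

lemma independent_mod_basis_exists:
  assumes sub: "Y \<subseteq> X"
    and S: "finite S" "\<And>x. x \<in> X \<Longrightarrow> Poly_Mapping.keys x \<subseteq> S"
  obtains D where "D \<subseteq> X" "independent_mod Y D" "card D + frag_rank Y = frag_rank X"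
proof -
  obtain BY where BY: "BY \<subseteq> rational_frag ` Y" "\<not> rat_fun.dependent BY"
      "rational_frag ` Y \<subseteq> rat_fun.span BY" "card BY = rat_fun.dim (rational_frag ` Y)"
    by (metis rat_fun.basis_exists)
  have "BY \<subseteq> rational_frag ` X" using BY sub by blast
  then obtain BX where BX: "BY \<subseteq> BX" "BX \<subseteq> rational_frag ` X" "\<not> rat_fun.dependent BX"
      "rational_frag ` X \<subseteq> rat_fun.span BX"
    using BY(2) rat_fun.maximal_independent_subset_extend by blast
  have finX: "finite BX"
  proof -
    have "BX \<subseteq> rat_fun.span (rational_frag ` frag_of ` S)"
      using BX(2) rational_frag_finite_basis[OF S] by (rule subset_trans)
    then show ?thesis
      using rat_fun.independent_span_bound[OF _ BX(3)] S(1) by blast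
  qed
  have "BX - BY \<subseteq> rational_frag ` X" using BX(2) by blast
  then obtain D where D: "D \<subseteq> X" "BX - BY = rational_frag ` D"
    by (meson subset_imageE)
  have "finite (rational_frag ` D)"
    using finX D(2) by (metis finite_Diff)
  then have finD: "finite D"
    by (metis finite_imageD inj_on_subset[OF inj_rational_frag] subset_UNIV)
  have "independent_mod Y D"
    unfolding independent_mod_def
  proof (intro conjI allI impI ballI)
    fix c d assume c: "(\<Sum>d\<in>D. frag_cmul (c d) d) \<in> Y" and d: "d \<in> D"
    define w where "w = rational_frag (\<Sum>d\<in>D. frag_cmul (c d) d)"
    have "w \<in> rat_fun.span BY" using c BY(3) by (auto simp: w_def)
    moreover have "finite BY" using BX(1) finX by (rule finite_subset)
    ultimately obtain u where u: "w = (\<Sum>v\<in>BY. (\<lambda>s. u v * v s))"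
      by (auto simp: rat_fun.span_finite)
    \<comment> \<open>The relation says that \<open>w\<close> has two expansions; their difference is a vanishing combination of the basis of the larger span.\<close>
    define q where "q v = (if v \<in> BY then u v else - of_int (c (inv_into UNIV rational_frag v)))" for v
    have "w = (\<Sum>d\<in>D. (\<lambda>s. of_int (c d) * rational_frag d s))"
      by (simp add: w_def rational_frag_sum)
    also have "\<dots> = (\<Sum>v\<in>BX - BY. (\<lambda>s. of_int (c (inv_into UNIV rational_frag v)) * v s))"
      unfolding D(2)
      by (subst sum.reindex)
         (auto simp: inv_f_f[OF inj_rational_frag] intro: inj_on_subset[OF inj_rational_frag])
    also have "\<dots> = - (\<Sum>v\<in>BX - BY. (\<lambda>s. q v * v s))"
      unfolding sum_negf[symmetric] by (intro sum.cong) (auto simp: q_def fun_eq_iff)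
    finally have w: "w = - (\<Sum>v\<in>BX - BY. (\<lambda>s. q v * v s))" .
    have "(\<Sum>v\<in>BX. (\<lambda>s. q v * v s)) =
        (\<Sum>v\<in>BX - BY. (\<lambda>s. q v * v s)) + (\<Sum>v\<in>BY. (\<lambda>s. q v * v s))"
      using BX(1) finX by (rule sum.subset_diff)
    also have "(\<Sum>v\<in>BY. (\<lambda>s. q v * v s)) = w"
      unfolding u by (intro sum.cong) (auto simp: q_def)
    also have "(\<Sum>v\<in>BX - BY. (\<lambda>s. q v * v s)) + w = 0"
      unfolding w by (rule right_minus)
    finally have "(\<Sum>v\<in>BX. (\<lambda>s. q v * v s)) = 0" .
    moreover have "rational_frag d \<in> BX - BY" using D(2) d by blast
    ultimately have "q (rational_frag d) = 0"
      by (intro rat_fun.independentD[OF BX(3) finX subset_refl]) auto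
    then show "c d = 0"
      using \<open>rational_frag d \<in> BX - BY\<close> by (simp add: q_def inv_f_f[OF inj_rational_frag])
  qed (use finD in auto)
  moreover have "card D + card BY = card BX"
  proof -
    have "card D = card (BX - BY)"
      unfolding D(2) by (simp add: card_image[OF inj_on_subset[OF inj_rational_frag]])
    then show ?thesis
      using BX(1) finX by (simp add: card_Diff_subset finite_subset card_mono)
  qed
  moreover have "card BX = rat_fun.dim (rational_frag ` X)"
    using BX by (intro rat_fun.basis_card_eq_dim)
  ultimately show ?thesis
    using that[of D] D(1) BY(4) by (simp add: frag_rank_def)
qed

lemma frag_rank_mono:
  assumes "Y \<subseteq> X" "finite S" "\<And>x. x \<in> X \<Longrightarrow> Poly_Mapping.keys x \<subseteq> S"
  shows "frag_rank Y \<le> frag_rank X"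
proof -
  obtain D where "D \<subseteq> X" "independent_mod Y D" "card D + frag_rank Y = frag_rank X"
    by (rule independent_mod_basis_exists[OF assms])
  then show ?thesis by linarith
qed

lemma frag_rank_0 [simp]: "frag_rank {0} = 0"
  using frag_rank_free[of "{}"] by simp

text \<open>
  Rank-nullity. A subset of \<open>X\<close> is independent modulo the kernel exactly when the homomorphism is
  injective on it and its image is independent, so both numbers count the same sets.
\<close>

lemma frag_rank_kernel_image:
  assumes X: "frag_subgroup X" and S: "finite S" "\<And>x. x \<in> X \<Longrightarrow> Poly_Mapping.keys x \<subseteq> S"
    and fX: "finite T" "\<And>x. x \<in> X \<Longrightarrow> Poly_Mapping.keys (frag_extend b x) \<subseteq> T"
  shows "frag_rank X = frag_rank {x \<in> X. frag_extend b x = 0} + frag_rank (frag_extend b ` X)"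
proof -
  let ?f = "frag_extend b" and ?K = "{x \<in> X. frag_extend b x = 0}" and ?I = "frag_extend b ` X"
  have K: "frag_subgroup ?K"
    using X by (intro frag_subgroupI) (auto simp: frag_subgroup_0 frag_subgroup_diff frag_extend_diff)
  have I: "frag_subgroup ?I"
  proof (rule frag_subgroupI)
    show "0 \<in> ?I" using frag_subgroup_0[OF X] by (metis frag_extend_0 imageI)
    fix x y assume "x \<in> ?I" "y \<in> ?I"
    then show "x - y \<in> ?I" using frag_subgroup_diff[OF X]
      by (auto simp flip: frag_extend_diff)
  qed
  have O: "frag_subgroup {0 :: 'b \<Rightarrow>\<^sub>0 int}" by (rule frag_subgroupI) auto
  have f_sum: "?f (\<Sum>d\<in>D. frag_cmul (c d) d) = (\<Sum>d\<in>D. frag_cmul (c d) (?f d))"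
    if "finite D" for c D
    using that by (simp add: frag_extend_sum frag_extend_cmul o_def)
  have IT: "Poly_Mapping.keys y \<subseteq> T" if "y \<in> ?I" for y
    using that fX(2) by blast
  show ?thesis
  proof (rule antisym)
    obtain D where D: "D \<subseteq> X" "independent_mod ?K D" "card D + frag_rank ?K = frag_rank X"
      using independent_mod_basis_exists[of ?K X S] S by auto
    have fin: "finite D" using D(2) by (simp add: independent_mod_def)
    have ker: "\<forall>d\<in>D. c d = 0" if "(\<Sum>d\<in>D. frag_cmul (c d) (?f d)) = 0" for c
    proof -
      have "(\<Sum>d\<in>D. frag_cmul (c d) d) \<in> X"
        using D(1) X by (intro frag_subgroup_sum frag_subgroup_cmul) auto
      then have "(\<Sum>d\<in>D. frag_cmul (c d) d) \<in> ?K"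
        using that f_sum[OF fin] by simp
      with D(2) show ?thesis by (simp add: independent_mod_def)
    qed
    have inj: "inj_on ?f D"
    proof (rule inj_onI, rule ccontr)
      fix x y assume xy: "x \<in> D" "y \<in> D" "?f x = ?f y" "x \<noteq> y"
      let ?c = "\<lambda>d. if d = x then 1 else if d = y then - 1 else (0::int)"
      have "(\<Sum>d\<in>D. frag_cmul (?c d) (?f d)) = (\<Sum>d\<in>{x, y}. frag_cmul (?c d) (?f d))"
        using xy fin by (intro sum.mono_neutral_right) auto
      also have "\<dots> = 0" using xy by simp
      finally have "\<forall>d\<in>D. ?c d = 0" by (rule ker)
      then have "?c x = 0" using xy(1) by (rule bspec)
      then show False by simp
    qed
    have "independent_mod {0} (?f ` D)"
      unfolding independent_mod_def
    proof (intro conjI allI impI ballI)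
      fix c y assume c: "(\<Sum>d\<in>?f ` D. frag_cmul (c d) d) \<in> {0}" and "y \<in> ?f ` D"
      have "(\<Sum>d\<in>D. frag_cmul (c (?f d)) (?f d)) = 0"
        using c by (simp add: sum.reindex[OF inj])
      then show "c y = 0" using ker[of "c \<circ> ?f"] \<open>y \<in> ?f ` D\<close> by auto
    qed (use fin in auto)
    then have "card (?f ` D) + frag_rank {0 :: 'b \<Rightarrow>\<^sub>0 int} \<le> frag_rank ?I"
      using independent_mod_card_le[OF I O _ fX(1) IT] D(1) frag_subgroup_0[OF I] by blast
    with D(3) show "frag_rank X \<le> frag_rank ?K + frag_rank ?I"
      by (simp add: card_image[OF inj])
  next
    obtain E where E: "E \<subseteq> ?I" "independent_mod {0} E" "card E + frag_rank {0 :: 'b \<Rightarrow>\<^sub>0 int} = frag_rank ?I"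
      using independent_mod_basis_exists[of "{0}" ?I T] fX(1) IT frag_subgroup_0[OF I] by auto
    obtain D where D: "D \<subseteq> X" "inj_on ?f D" "E = ?f ` D"
      using E(1) by (meson subset_image_inj)
    have fin: "finite D" using E(2) D finite_imageD by (auto simp: independent_mod_def)
    have "independent_mod ?K D"
      unfolding independent_mod_def
    proof (intro conjI allI impI ballI)
      fix c d assume "(\<Sum>d\<in>D. frag_cmul (c d) d) \<in> ?K" and d: "d \<in> D"
      then have "(\<Sum>d\<in>D. frag_cmul (c d) (?f d)) = 0" using f_sum[OF fin, of c] by simp
      then have "(\<Sum>e\<in>E. frag_cmul (c (inv_into D ?f e)) e) = 0"
        unfolding D(3) by (simp add: sum.reindex[OF D(2)] inv_into_f_f[OF D(2)])
      then have "\<forall>e\<in>E. c (inv_into D ?f e) = 0"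
        using E(2) unfolding independent_mod_def by fastforce
      then show "c d = 0" using d D by (auto simp: inv_into_f_f[OF D(2)])
    qed (use fin in auto)
    then have "card D + frag_rank ?K \<le> frag_rank X"
      using independent_mod_card_le[OF X K _ S] D(1) by blast
    with E(3) show "frag_rank ?K + frag_rank ?I \<le> frag_rank X"
      by (simp add: D(3) card_image[OF D(2)])
  qed
qed

text \<open>
  The supremum in the definition of \<open>abelian_rank\<close> is attained: independent sets of cosets and sets
  of representatives that are independent modulo the subgroup have the same cardinalities.
\<close>

lemma abelian_rank_quotient:
  fixes S :: "'e set"
  assumes S: "finite S"
    and Z: "subgroup Z (free_Abelian_group S)" and B: "subgroup B (free_Abelian_group S)"
    and sub: "B \<subseteq> Z"
  shows "abelian_rank (subgroup_generated (free_Abelian_group S) Z Mod B) =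
    frag_rank Z - frag_rank B"
proof -
  define H where "H = subgroup_generated (free_Abelian_group S) Z"
  define Q where "Q = H Mod B"
  define \<phi> where "\<phi> x = B #>\<^bsub>H\<^esub> x" for x
  have keysZ: "Poly_Mapping.keys x \<subseteq> S" if "x \<in> Z" for x
    using that subgroup.mem_carrier[OF Z] by simp
  have G: "comm_group (free_Abelian_group S)" by (rule abelian_free_Abelian_group)
  have H: "comm_group H"
    unfolding H_def by (rule group.abelian_subgroup_generated) (auto simp: G)
  have carH: "carrier H = Z"
    unfolding H_def by (rule subgroup.carrier_subgroup_generated_subgroup[OF Z])
  interpret H: comm_group H by (rule H)
  have BH: "subgroup B H"
    unfolding H_def using B Z sub
    by (simp add: group.subgroup_subgroup_generated_iff subgroup.carrier_subgroup_generated_subgroup)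
  interpret B: normal B H
    using BH by (simp add: H.normal_iff_subgroup)
  interpret Q: comm_group Q
    unfolding Q_def by (rule H.abelian_FactGroup[OF BH])
  have hom: "\<phi> \<in> hom H Q"
    unfolding \<phi>_def Q_def by (rule B.r_coset_hom_Mod)
  then interpret \<phi>: group_hom H Q \<phi>
    by (simp add: group_hom_def group_hom_axioms_def H.is_group Q.is_group)
  have surj: "carrier Q = \<phi> ` Z"
    unfolding Q_def \<phi>_def carrier_FactGroup carH by simp
  have ker: "\<phi> x = \<one>\<^bsub>Q\<^esub> \<longleftrightarrow> x \<in> B" if "x \<in> Z" for x
    using that carH unfolding \<phi>_def Q_def
    by (auto simp: H.coset_join2[OF _ BH] intro: H.coset_join1[OF _ _ BH])
  have Zsub: "frag_subgroup Z" and Bsub: "frag_subgroup B"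
  proof -
    have "frag_subgroup X" if X: "subgroup X (free_Abelian_group S)" for X
    proof (rule frag_subgroupI)
      show "0 \<in> X" using subgroup.one_closed[OF X] by simp
      fix x y assume xy: "x \<in> X" "y \<in> X"
      have "Poly_Mapping.keys y \<subseteq> S" using subgroup.mem_carrier[OF X xy(2)] by simp
      then have "- y \<in> X" using subgroup.m_inv_closed[OF X xy(2)] by simp
      with xy show "x - y \<in> X" using subgroup.m_closed[OF X xy(1)] by fastforce
    qed
    with Z B show "frag_subgroup Z" "frag_subgroup B" by auto
  qed
  have pow: "\<phi> (frag_cmul k x) = \<phi> x [^]\<^bsub>Q\<^esub> k" if "x \<in> Z" for x and k :: int
  proof -
    have "x [^]\<^bsub>H\<^esub> k = frag_cmul k x"
      unfolding H_def using that carH keysZ[OF that]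
      by (subst group.int_pow_subgroup_generated) (auto simp: H_def)
    then show ?thesis using \<phi>.hom_int_pow[of x k] that carH by simp
  qed
  have fp: "\<phi> (\<Sum>d\<in>D. frag_cmul (c d) d) = (\<Otimes>\<^bsub>Q\<^esub>d\<in>D. \<phi> d [^]\<^bsub>Q\<^esub> c d)"
    if "finite D" "D \<subseteq> Z" for D and c :: "('e \<Rightarrow>\<^sub>0 int) \<Rightarrow> int"
    using that
  proof (induction D)
    case empty
    show ?case using ker[of 0] frag_subgroup_0[OF Zsub] frag_subgroup_0[OF Bsub] by simp
  next
    case (insert x D)
    have "frag_cmul (c x) x \<in> Z" "(\<Sum>d\<in>D. frag_cmul (c d) d) \<in> Z"
      using insert by (auto intro!: frag_subgroup_cmul[OF Zsub] frag_subgroup_sum[OF Zsub])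
    then have "\<phi> (frag_cmul (c x) x + (\<Sum>d\<in>D. frag_cmul (c d) d)) =
        \<phi> (frag_cmul (c x) x) \<otimes>\<^bsub>Q\<^esub> \<phi> (\<Sum>d\<in>D. frag_cmul (c d) d)"
      using \<phi>.hom_mult[of "frag_cmul (c x) x" "\<Sum>d\<in>D. frag_cmul (c d) d"] carH
      by (simp add: H_def)
    moreover have "(\<lambda>d. \<phi> d [^]\<^bsub>Q\<^esub> c d) \<in> insert x D \<rightarrow> carrier Q"
      using insert.prems carH by (auto intro!: Q.int_pow_closed \<phi>.hom_closed)
    ultimately show ?case
      using insert pow[of x] by (simp add: Pi_iff)
  qed
  \<comment> \<open>Taking one representative per coset, and conversely the cosets of the elements, preserves cardinality and independence.\<close>
  have "card ` {\<D>. int_independent Q \<D>} = card ` {D. D \<subseteq> Z \<and> independent_mod B D}"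
  proof (intro equalityI subsetI; elim imageE; clarify)
    fix \<D> assume \<D>: "int_independent Q \<D>"
    then have fin: "finite \<D>" and car: "\<D> \<subseteq> \<phi> ` Z" by (auto simp: int_independent_def surj)
    obtain D where D: "D \<subseteq> Z" "inj_on \<phi> D" "\<D> = \<phi> ` D"
      using car by (meson subset_image_inj)
    have finD: "finite D" using fin D finite_imageD by blast
    have "independent_mod B D"
      unfolding independent_mod_def
    proof (intro conjI allI impI ballI)
      fix c d assume c: "(\<Sum>d\<in>D. frag_cmul (c d) d) \<in> B" and d: "d \<in> D"
      have "(\<Otimes>\<^bsub>Q\<^esub>K\<in>\<D>. K [^]\<^bsub>Q\<^esub> c (inv_into D \<phi> K)) =
          (\<Otimes>\<^bsub>Q\<^esub>d\<in>D. \<phi> d [^]\<^bsub>Q\<^esub> c (inv_into D \<phi> (\<phi> d)))"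
        unfolding D(3) using D(1,2) carH
        by (intro Q.finprod_reindex) (auto intro!: Q.int_pow_closed \<phi>.hom_closed)
      also have "\<dots> = (\<Otimes>\<^bsub>Q\<^esub>d\<in>D. \<phi> d [^]\<^bsub>Q\<^esub> c d)"
        using D(1,2) carH
        by (intro Q.finprod_cong') (auto intro!: Q.int_pow_closed \<phi>.hom_closed simp: inv_into_f_f)
      also have "\<dots> = \<one>\<^bsub>Q\<^esub>"
        using fp[OF finD D(1), of c] ker c sub by (metis subsetD)
      finally have "c (inv_into D \<phi> (\<phi> d)) = 0"
        using \<D> d D(3) unfolding int_independent_def
        by (elim conjE allE[of _ "\<lambda>K. c (inv_into D \<phi> K)"]) blast
      then show "c d = 0" using d D(2) by (simp add: inv_into_f_f)
    qed (use finD in auto)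
    then show "card \<D> \<in> card ` {D. D \<subseteq> Z \<and> independent_mod B D}"
      using D by (auto simp: card_image intro!: image_eqI[of _ _ D])
  next
    fix D assume D: "D \<subseteq> Z" "independent_mod B D"
    have fin: "finite D" using D(2) by (simp add: independent_mod_def)
    have indep: "\<forall>d\<in>D. c d = 0" if "(\<Otimes>\<^bsub>Q\<^esub>d\<in>D. \<phi> d [^]\<^bsub>Q\<^esub> c d) = \<one>\<^bsub>Q\<^esub>" for c :: "_ \<Rightarrow> int"
    proof -
      have "(\<Sum>d\<in>D. frag_cmul (c d) d) \<in> Z"
        using D(1) by (intro frag_subgroup_sum[OF Zsub] frag_subgroup_cmul[OF Zsub]) auto
      then have "(\<Sum>d\<in>D. frag_cmul (c d) d) \<in> B"
        using ker fp[OF fin D(1), of c] that by simp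
      then show ?thesis using D(2) by (simp add: independent_mod_def)
    qed
    have inj: "inj_on \<phi> D"
    proof (rule inj_onI, rule ccontr)
      fix x y assume xy: "x \<in> D" "y \<in> D" "\<phi> x = \<phi> y" "x \<noteq> y"
      let ?c = "\<lambda>d. if d = x then 1 else if d = y then - 1 else (0::int)"
      have "(\<Sum>d\<in>D. frag_cmul (?c d) d) = (\<Sum>d\<in>{x, y}. frag_cmul (?c d) d)"
        using xy fin by (intro sum.mono_neutral_right) auto
      also have "\<dots> = x - y" using xy by simp
      also have "\<dots> \<in> B"
      proof -
        have Zxy: "x \<in> Z" "y \<in> Z" using xy D(1) by auto
        then have "frag_cmul (- 1) y \<in> Z" by (intro frag_subgroup_cmul[OF Zsub])
        then have "\<phi> (x + frag_cmul (- 1) y) = \<phi> x \<otimes>\<^bsub>Q\<^esub> \<phi> (frag_cmul (- 1) y)"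
          using Zxy \<phi>.hom_mult[of x "frag_cmul (- 1) y"] carH by (simp add: H_def)
        also have "\<dots> = \<phi> y \<otimes>\<^bsub>Q\<^esub> inv\<^bsub>Q\<^esub> \<phi> y"
          using pow[OF Zxy(2), of "- 1"] xy(3) Zxy carH
          by (simp add: Q.int_pow_neg \<phi>.hom_closed)
        also have "\<dots> = \<one>\<^bsub>Q\<^esub>" using Zxy carH by (simp add: \<phi>.hom_closed)
        finally have "\<phi> (x - y) = \<one>\<^bsub>Q\<^esub>" by simp
        then show ?thesis using ker frag_subgroup_diff[OF Zsub] Zxy by blast
      qed
      finally have "\<forall>d\<in>D. ?c d = 0"
        using D(2) unfolding independent_mod_def by (elim conjE allE impE)
      then have "?c x = 0" using xy(1) by (rule bspec)
      then show False by simp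
    qed
    have "int_independent Q (\<phi> ` D)"
      unfolding int_independent_def
    proof (intro conjI allI impI)
      fix c :: "_ \<Rightarrow> int"
      assume c: "(\<Otimes>\<^bsub>Q\<^esub>K\<in>\<phi> ` D. K [^]\<^bsub>Q\<^esub> c K) = \<one>\<^bsub>Q\<^esub>"
      have "(\<Otimes>\<^bsub>Q\<^esub>K\<in>\<phi> ` D. K [^]\<^bsub>Q\<^esub> c K) = (\<Otimes>\<^bsub>Q\<^esub>d\<in>D. \<phi> d [^]\<^bsub>Q\<^esub> c (\<phi> d))"
        using D(1) carH inj
        by (intro Q.finprod_reindex) (auto intro!: Q.int_pow_closed \<phi>.hom_closed)
      then show "\<forall>K\<in>\<phi> ` D. c K = 0"
        using indep[of "c \<circ> \<phi>"] c by simp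
    qed (use fin D(1) surj in auto)
    then show "card D \<in> card ` {\<D>. int_independent Q \<D>}"
      using inj by (auto simp: card_image intro!: image_eqI[of _ _ "\<phi> ` D"])
  qed
  then have "abelian_rank Q = Sup (card ` {D. D \<subseteq> Z \<and> independent_mod B D})"
    by (simp add: abelian_rank_def)
  also have "\<dots> = frag_rank Z - frag_rank B"
  proof (rule cSup_eq_maximum)
    obtain D where "D \<subseteq> Z" "independent_mod B D" "card D + frag_rank B = frag_rank Z"
      using independent_mod_basis_exists[OF sub S keysZ] by metis
    then show "frag_rank Z - frag_rank B \<in> card ` {D. D \<subseteq> Z \<and> independent_mod B D}"
      by (intro image_eqI[of _ _ D]) auto
    fix n assume "n \<in> card ` {D. D \<subseteq> Z \<and> independent_mod B D}"
    then obtain D where D: "D \<subseteq> Z" "independent_mod B D" "n = card D" by blast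
    then show "n \<le> frag_rank Z - frag_rank B"
      using independent_mod_card_le[OF Zsub Bsub sub S keysZ D(1,2)] by linarith
  qed
  finally show ?thesis by (simp add: Q_def H_def)
qed

section \<open>Classes of a symmetric relation enlarged by a square\<close>

lemma sym_rtrancl_class:
  assumes R: "sym R" and ab: "(a, b) \<in> R\<^sup>*"
  shows "R\<^sup>* `` {a} = R\<^sup>* `` {b}"
proof -
  have ba: "(b, a) \<in> R\<^sup>*" using symD[OF sym_rtrancl[OF R] ab] .
  have "(a, x) \<in> R\<^sup>* \<longleftrightarrow> (b, x) \<in> R\<^sup>*" for x
    using rtrancl_trans[OF ab, of x] rtrancl_trans[OF ba, of x] by blast
  then show ?thesis by auto
qed

text \<open>
  Relating all elements of \<open>L\<close> to each other merges exactly the classes that meet \<open>L\<close>.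
\<close>

lemma rtrancl_Un_square_Image:
  fixes R :: "'a rel"
  assumes R: "sym R"
  shows "(R \<union> L \<times> L)\<^sup>* `` {a} = (if R\<^sup>* `` {a} \<inter> L = {} then R\<^sup>* `` {a} else R\<^sup>* `` L)"
proof -
  have sym: "sym (R\<^sup>*)" using R by (rule sym_rtrancl)
  have mono: "R\<^sup>* \<subseteq> (R \<union> L \<times> L)\<^sup>*" by (rule rtrancl_mono) auto
  have step: "b \<in> R\<^sup>* `` {a} \<or> (R\<^sup>* `` {a} \<inter> L \<noteq> {} \<and> b \<in> R\<^sup>* `` L)"
    if "(a, b) \<in> (R \<union> L \<times> L)\<^sup>*" for b
    using that
  proof (induction rule: rtrancl_induct)
    case (step b c)
    show ?case
    proof (cases "(b, c) \<in> R")
      case True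
      then show ?thesis using step.IH by (meson Image_iff rtrancl.rtrancl_into_rtrancl)
    next
      case False
      then have bc: "b \<in> L" "c \<in> L" using step.hyps by auto
      then show ?thesis using step.IH by blast
    qed
  qed auto
  show ?thesis
  proof (cases "R\<^sup>* `` {a} \<inter> L = {}")
    case True
    then show ?thesis using step mono by auto
  next
    case False
    then obtain l where l: "(a, l) \<in> R\<^sup>*" "l \<in> L" by auto
    have "R\<^sup>* `` {a} \<subseteq> R\<^sup>* `` L"
    proof
      fix b assume "b \<in> R\<^sup>* `` {a}"
      then have "(l, b) \<in> R\<^sup>*" using sym_rtrancl_class[OF R l(1)] by auto
      with l show "b \<in> R\<^sup>* `` L" by auto
    qed
    moreover have "R\<^sup>* `` L \<subseteq> (R \<union> L \<times> L)\<^sup>* `` {a}"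
    proof
      fix b assume "b \<in> R\<^sup>* `` L"
      then obtain l' where l': "l' \<in> L" "(l', b) \<in> R\<^sup>*" by auto
      have "(a, l) \<in> (R \<union> L \<times> L)\<^sup>*" using l mono by auto
      also have "(l, l') \<in> R \<union> L \<times> L" using l l' by auto
      also have "(l', b) \<in> (R \<union> L \<times> L)\<^sup>*" using l' mono by auto
      finally show "b \<in> (R \<union> L \<times> L)\<^sup>* `` {a}" by auto
    qed
    ultimately show ?thesis using step False by auto
  qed
qed

section \<open>Matching edges and the edge-ends at them\<close>

context matched_trivalent_graph
begin

lemma matching_edge:
  assumes "e \<in> M"
  obtains x where "x \<in> arcs G" "e = {x, arev x}" "tail G x \<noteq> tail G (arev x)"
proof -
  from assms matching have "e \<in> edges G arev" "card (end_nodes G e) = 2"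
    by (auto simp: perfect_matching_def)
  then obtain x where x: "x \<in> arcs G" "e = {x, arev x}" "card (tail G ` {x, arev x}) = 2"
    by (auto simp: edges_def end_nodes_def)
  then have "tail G x \<noteq> tail G (arev x)" by (auto simp: card_insert_if split: if_splits)
  with x that show ?thesis by blast
qed

lemma finite_M: "finite M"
proof -
  have "M \<subseteq> (\<lambda>a. {a, arev a}) ` arcs G"
    using matching by (auto simp: perfect_matching_def edges_def)
  then show ?thesis by (rule finite_subset) auto
qed

lemma site_at_node_unique:
  "e \<in> M \<Longrightarrow> e' \<in> M \<Longrightarrow> v \<in> end_nodes G e \<Longrightarrow> v \<in> end_nodes G e' \<Longrightarrow> e = e'"
  using matching unfolding perfect_matching_def pairwise_def disjnt_def by blast

lemma finite_free_ends [simp]: "finite free_ends"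
  by (auto simp: free_ends_def)

lemma arev_free_end:
  assumes "a \<in> free_ends"
  shows "arev a \<in> free_ends"
proof -
  have a: "a \<in> arcs G" "a \<notin> \<Union>M" using assms by (auto simp: free_ends_def)
  have "arev a \<notin> \<Union>M"
  proof
    assume "arev a \<in> \<Union>M"
    then obtain e where e: "e \<in> M" "arev a \<in> e" by blast
    obtain x where x: "x \<in> arcs G" "e = {x, arev x}"
      by (rule matching_edge[OF e(1)])
    have "a \<in> e" using e(2) x by (metis arev_arev insert_iff singletonD)
    then show False using a e by blast
  qed
  then show ?thesis using a by (auto simp: free_ends_def)
qed

text \<open>
  Of the three edge-ends at a node exactly one belongs to a matching edge, because the matching edges
  are disjoint and none of them is a loop.
\<close>

lemma card_free_ends_at:
  assumes "v \<in> verts G"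
  shows "card {c \<in> free_ends. tail G c = v} = 2"
proof -
  have "v \<in> (\<Union>e\<in>M. end_nodes G e)"
    using matching assms by (simp add: perfect_matching_def)
  then obtain e where e: "e \<in> M" "v \<in> end_nodes G e" by blast
  obtain y where y: "y \<in> arcs G" "e = {y, arev y}" "tail G y \<noteq> tail G (arev y)"
    by (rule matching_edge[OF e(1)])
  obtain x where x: "x \<in> e" "tail G x = v" using e by (auto simp: end_nodes_def)
  have uniq: "z = x" if z: "z \<in> \<Union>M" "tail G z = v" for z
  proof -
    obtain e' where e': "e' \<in> M" "z \<in> e'" using z by blast
    have "e' = e"
      using e e' z by (intro site_at_node_unique[of _ _ v]) (auto simp: end_nodes_def)
    then show ?thesis using e' x y z by auto
  qed
  have xa: "x \<in> arcs G" using x y by auto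
  have "x \<in> \<Union>M" using e(1) x(1) by blast
  then have "{c \<in> free_ends. tail G c = v} = out_arcs G v - {x}"
    using uniq unfolding free_ends_def out_arcs_def by blast
  moreover have "card (out_arcs G v) = 3"
    using trivalent[OF assms] by (simp add: out_degree_def)
  moreover have "x \<in> out_arcs G v" using x xa by auto
  ultimately show ?thesis by (simp add: card_Diff_singleton)
qed

lemma free_end_tail: "a \<in> free_ends \<Longrightarrow> tail G a \<in> verts G"
  by (auto simp: free_ends_def)

lemma par_free_end: "a \<in> free_ends \<Longrightarrow> par a \<in> free_ends"
  using par_end by (simp add: free_ends_def)

lemma par_par_free_end: "a \<in> free_ends \<Longrightarrow> par (par a) = a"
  using par_par by (simp add: free_ends_def)

lemma site_at_free_end:
  assumes "a \<in> free_ends"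
  obtains e where "e \<in> M" "a \<in> legs e" "end_nodes G e = {tail G a, tail G (par a)}"
    "tail G a \<noteq> tail G (par a)"
proof -
  have "\<exists>e\<in>M. end_nodes G e = {tail G a, tail G (par a)}"
    using assms by (intro par_across) (simp add: free_ends_def)
  then obtain e where e: "e \<in> M" "end_nodes G e = {tail G a, tail G (par a)}" by blast
  have "card (end_nodes G e) = 2"
    using e(1) matching by (auto simp: perfect_matching_def)
  then have "tail G a \<noteq> tail G (par a)" using e(2) by auto
  with e show ?thesis
    using that assms by (auto simp: legs_def)
qed

lemma site_of_eq:
  assumes "e \<in> M" "a \<in> legs e"
  shows "site_of a = e"
  unfolding site_of_def
proof (rule the_equality)
  show "e \<in> M \<and> a \<in> legs e" using assms by simp
  fix e' assume "e' \<in> M \<and> a \<in> legs e'"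
  then show "e' = e"
    using assms site_at_node_unique[of e' e "tail G a"] by (simp add: legs_def)
qed

lemma site_of_free_end: "a \<in> free_ends \<Longrightarrow> site_of a \<in> M \<and> a \<in> legs (site_of a)"
  by (metis site_at_free_end site_of_eq)

lemma end_nodes_site:
  assumes "e \<in> M" "a \<in> legs e"
  shows "end_nodes G e = {tail G a, tail G (par a)}" "tail G a \<noteq> tail G (par a)"
proof -
  have a: "a \<in> free_ends" using assms by (simp add: legs_def)
  obtain e' where e': "e' \<in> M" "a \<in> legs e'" "end_nodes G e' = {tail G a, tail G (par a)}"
    "tail G a \<noteq> tail G (par a)"
    by (rule site_at_free_end[OF a])
  have "e = e'" using site_of_eq[OF assms] site_of_eq[OF e'(1,2)] by simp
  with e' show "end_nodes G e = {tail G a, tail G (par a)}" "tail G a \<noteq> tail G (par a)"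
    by auto
qed

lemma par_legs: "e \<in> M \<Longrightarrow> a \<in> legs e \<Longrightarrow> par a \<in> legs e"
  using end_nodes_site(1)[of e a] par_free_end[of a] unfolding legs_def by simp

lemma crs_props:
  assumes "a \<in> free_ends"
  shows "crs a \<in> free_ends" "tail G (crs a) = tail G (par a)" "crs a \<noteq> par a"
    and crs_unique: "\<And>c. c \<in> free_ends \<Longrightarrow> tail G c = tail G (par a) \<Longrightarrow> c \<noteq> par a \<Longrightarrow> c = crs a"
proof -
  let ?P = "\<lambda>c. c \<in> free_ends \<and> tail G c = tail G (par a) \<and> c \<noteq> par a"
  have "card {c \<in> free_ends. tail G c = tail G (par a)} = 2"
    using assms by (intro card_free_ends_at free_end_tail par_free_end)
  then obtain x y where xy: "{c \<in> free_ends. tail G c = tail G (par a)} = {x, y}" "x \<noteq> y"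
    by (auto simp: card_2_iff)
  have "par a \<in> {x, y}" using par_free_end[OF assms] xy(1) by blast
  then obtain c where c: "{c \<in> free_ends. tail G c = tail G (par a)} = {par a, c}" "c \<noteq> par a"
    using xy by blast
  then have "?P d \<longleftrightarrow> d = c" for d by blast
  then have ex1: "\<exists>!c. ?P c" by simp
  from theI'[OF this] show "crs a \<in> free_ends" "tail G (crs a) = tail G (par a)" "crs a \<noteq> par a"
    by (auto simp: crs_def)
  fix c assume "c \<in> free_ends" "tail G c = tail G (par a)" "c \<noteq> par a"
  then show "c = crs a"
    unfolding crs_def by (intro the1_equality[OF ex1, symmetric]) auto
qed

lemma crs_legs: "e \<in> M \<Longrightarrow> a \<in> legs e \<Longrightarrow> crs a \<in> legs e"
  using end_nodes_site(1)[of e a] crs_props(1,2)[of a] unfolding legs_def by simp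

lemma crs_crs:
  assumes a: "a \<in> free_ends"
  shows "crs (crs a) = a"
proof (rule sym, rule crs_unique)
  show c: "crs a \<in> free_ends" using a by (rule crs_props)
  obtain e where e: "e \<in> M" "a \<in> legs e" using site_of_free_end[OF a] by blast
  have "end_nodes G e = {tail G a, tail G (par a)}" "tail G a \<noteq> tail G (par a)"
    using end_nodes_site[OF e] by auto
  moreover have "end_nodes G e = {tail G (crs a), tail G (par (crs a))}"
      "tail G (crs a) \<noteq> tail G (par (crs a))"
    using end_nodes_site[OF e(1) crs_legs[OF e]] by auto
  ultimately show "tail G a = tail G (par (crs a))"
    using crs_props(2)[OF a] by (metis doubleton_eq_iff)
  show "a \<noteq> par (crs a)"
    using crs_props(3)[OF a] par_par_free_end[OF c] by metis
qed (fact a)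

lemma arc_end_legs: "e \<in> M \<Longrightarrow> a \<in> legs e \<Longrightarrow> arc_end S a \<in> legs e"
  by (simp add: arc_end_def par_legs crs_legs)

lemma arc_end_free_end: "a \<in> free_ends \<Longrightarrow> arc_end S a \<in> free_ends"
  by (simp add: arc_end_def par_free_end crs_props)

lemma arc_end_arc_end:
  assumes a: "a \<in> free_ends"
  shows "arc_end S (arc_end S a) = a"
proof -
  have "site_of (arc_end S a) = site_of a"
    using site_of_free_end[OF a] by (intro site_of_eq arc_end_legs) auto
  then show ?thesis using a by (simp add: arc_end_def par_par_free_end crs_crs)
qed

section \<open>Components as connectivity classes\<close>

text \<open>
  The relation generating the components directly on edge-ends: consecutive edge-ends of a walk, and
  any two edge-ends at the same nodal crossing.
\<close>

definition contact :: "('b set \<Rightarrow> resolution) \<Rightarrow> 'b rel" where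
  "contact S = walk_step S \<union> (\<Union>e\<in>nodal_sites S. legs e \<times> legs e)"

lemma sym_walk_step: "sym (walk_step S)"
proof (rule symI)
  fix a b assume "(a, b) \<in> walk_step S"
  then have a: "a \<in> free_ends" and "b = arev a \<or> b = arc_end S a"
    by (auto simp: walk_step_def)
  then show "(b, a) \<in> walk_step S"
    using arev_free_end[OF a] arc_end_free_end[OF a] arc_end_arc_end[OF a]
    by (auto simp: walk_step_def free_ends_def)
qed

lemma sym_contact: "sym (contact S)"
  unfolding contact_def by (intro sym_Un sym_walk_step) (auto simp: sym_def)

lemma contact_free_ends: "(a, b) \<in> contact S \<Longrightarrow> a \<in> free_ends \<and> b \<in> free_ends"
  unfolding contact_def walk_step_def legs_def
  using arev_free_end arc_end_free_end by blast

lemma rtrancl_contact_free_ends: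
  "(a, b) \<in> (contact S)\<^sup>* \<Longrightarrow> a \<in> free_ends \<Longrightarrow> b \<in> free_ends"
  by (induction rule: rtrancl_induct) (auto dest: contact_free_ends)

lemma walk_class_eq: "(a, b) \<in> (walk_step S)\<^sup>* \<Longrightarrow> (walk_step S)\<^sup>* `` {a} = (walk_step S)\<^sup>* `` {b}"
  by (rule sym_rtrancl_class[OF sym_walk_step])

lemma contact_class_eq: "(a, b) \<in> (contact S)\<^sup>* \<Longrightarrow> (contact S)\<^sup>* `` {a} = (contact S)\<^sup>* `` {b}"
  by (rule sym_rtrancl_class[OF sym_contact])

lemma Union_loops_class:
  assumes a: "a \<in> free_ends"
  shows "\<Union> ((loops_meet S)\<^sup>* `` {(walk_step S)\<^sup>* `` {a}}) = (contact S)\<^sup>* `` {a}"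
    (is "\<Union> (_ `` {?W a}) = ?C a")
proof (intro equalityI subsetI)
  have WC: "?W b \<subseteq> ?C b" for b
    using rtrancl_mono[of "walk_step S" "contact S"] by (auto simp: contact_def)
  fix b assume "b \<in> \<Union> ((loops_meet S)\<^sup>* `` {?W a})"
  then obtain L where L: "(?W a, L) \<in> (loops_meet S)\<^sup>*" "b \<in> L" by auto
  from L(1) have "L \<subseteq> ?C a"
  proof (induction rule: rtrancl_induct)
    case base
    show ?case by (rule WC)
  next
    case (step L L')
    then obtain e x y where e: "e \<in> nodal_sites S" "x \<in> L" "x \<in> legs e" "y \<in> L'" "y \<in> legs e"
        "L' \<in> loops S"
      unfolding loops_meet_def by blast
    then obtain z where z: "L' = ?W z" by (auto simp: loops_def quotient_def)
    then have "L' = ?W y" using e(4) walk_class_eq[of z y S] by auto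
    then have "L' \<subseteq> ?C y" using WC by auto
    moreover have "(x, y) \<in> contact S" using e by (auto simp: contact_def)
    moreover have "(a, x) \<in> (contact S)\<^sup>*" using e step.IH by auto
    ultimately show ?case
      using contact_class_eq[of a y S] by (metis rtrancl_into_rtrancl)
  qed
  with L show "b \<in> ?C a" by blast
next
  fix b assume "b \<in> ?C a"
  then have "(a, b) \<in> (contact S)\<^sup>*" by simp
  then have "(?W a, ?W b) \<in> (loops_meet S)\<^sup>*"
  proof (induction rule: rtrancl_induct)
    case (step b c)
    show ?case
    proof (cases "(b, c) \<in> walk_step S")
      case True
      then have "?W b = ?W c" by (intro walk_class_eq) auto
      with step.IH show ?thesis by simp
    next
      case False
      then obtain e where e: "e \<in> nodal_sites S" "b \<in> legs e" "c \<in> legs e"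
        using step.hyps by (auto simp: contact_def)
      then have "?W b \<in> loops S" "?W c \<in> loops S"
        by (auto simp: loops_def legs_def intro: quotientI)
      with e have "(?W b, ?W c) \<in> loops_meet S"
        unfolding loops_meet_def by blast
      with step.IH show ?thesis by (rule rtrancl_into_rtrancl)
    qed
  qed auto
  then show "b \<in> \<Union> ((loops_meet S)\<^sup>* `` {?W a})" by blast
qed

text \<open>
  Grouping edge-ends into loops and loops into components amounts to one equivalence relation.
\<close>

lemma components_eq: "components S = (\<lambda>a. (contact S)\<^sup>* `` {a}) ` free_ends"
proof -
  have "components S = (\<lambda>a. \<Union> ((loops_meet S)\<^sup>* `` {(walk_step S)\<^sup>* `` {a}})) ` free_ends"
    unfolding components_def loops_def quotient_def by blast
  also have "\<dots> = (\<lambda>a. (contact S)\<^sup>* `` {a}) ` free_ends"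
    by (intro image_cong refl Union_loops_class)
  finally show ?thesis .
qed

lemma finite_components [simp]: "finite (components S)"
  by (simp add: components_eq)

lemma component_nonempty: "K \<in> components S \<Longrightarrow> K \<noteq> {}"
  by (auto simp: components_eq)

lemma component_eq_class: "K \<in> components S \<Longrightarrow> a \<in> K \<Longrightarrow> K = (contact S)\<^sup>* `` {a}"
  using contact_class_eq by (auto simp: components_eq)

lemma component_subset: "K \<in> components S \<Longrightarrow> K \<subseteq> free_ends"
  using rtrancl_contact_free_ends by (auto simp: components_eq)

lemma component_unique:
  "K \<in> components S \<Longrightarrow> K' \<in> components S \<Longrightarrow> a \<in> K \<Longrightarrow> a \<in> K' \<Longrightarrow> K = K'"
  using component_eq_class by metis

text \<open>
  The contacts at a site that is being made nodal stay within its four edge-ends, whatever its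
  resolution was, so they are absorbed by the square of that set.
\<close>

lemma contact_update:
  assumes e: "e \<in> M"
  shows "contact (S(e := Nodal)) = contact S \<union> legs e \<times> legs e"
proof -
  have nodal: "nodal_sites (S(e := Nodal)) = insert e (nodal_sites S)"
    using e by (auto simp: nodal_sites_def)
  have "(a, b) \<in> walk_step (S(e := Nodal)) \<union> legs e \<times> legs e \<longleftrightarrow>
      (a, b) \<in> walk_step S \<union> legs e \<times> legs e" for a b
  proof (cases "a \<in> legs e")
    case True
    then show ?thesis
      using e arc_end_legs[OF e True, of S] arc_end_legs[OF e True, of "S(e := Nodal)"]
      by (auto simp: walk_step_def)
  next
    case False
    then have "arc_end (S(e := Nodal)) a = arc_end S a" if "a \<in> free_ends"
      using site_of_free_end[OF that] by (auto simp: arc_end_def)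
    then show ?thesis using False by (auto simp: walk_step_def)
  qed
  then have "walk_step (S(e := Nodal)) \<union> legs e \<times> legs e = walk_step S \<union> legs e \<times> legs e"
    by auto
  then show ?thesis unfolding contact_def nodal by blast
qed

text \<open>
  A component of the new state away from the site is a component of the old one; the component
  through the site is the union of the old components that meet it.
\<close>

lemma component_update:
  assumes e: "e \<in> M" and K': "K' \<in> components (S(e := Nodal))"
  shows "K' \<inter> legs e = {} \<Longrightarrow> {K \<in> components S. K \<subseteq> K'} = {K'}"
    and "K' \<inter> legs e \<noteq> {} \<Longrightarrow>
      {K \<in> components S. K \<subseteq> K'} = {K \<in> components S. K \<inter> legs e \<noteq> {}}"
proof -
  let ?C = "\<lambda>a. (contact S)\<^sup>* `` {a}"
  obtain a where a: "a \<in> free_ends" "K' = (contact S \<union> legs e \<times> legs e)\<^sup>* `` {a}"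
    using K' by (auto simp: components_eq contact_update[OF e])
  have K'_eq: "K' = (if ?C a \<inter> legs e = {} then ?C a else (contact S)\<^sup>* `` legs e)"
    unfolding a(2) by (rule rtrancl_Un_square_Image[OF sym_contact])
  have aK: "?C a \<in> components S" "a \<in> ?C a" using a(1) by (auto simp: components_eq)
  show "{K \<in> components S. K \<subseteq> K'} = {K'}" if "K' \<inter> legs e = {}"
  proof -
    have K'C: "K' = ?C a"
    proof (rule ccontr)
      assume "K' \<noteq> ?C a"
      then have "K' = (contact S)\<^sup>* `` legs e" "?C a \<inter> legs e \<noteq> {}"
        using K'_eq by (auto split: if_splits)
      then show False using that by blast
    qed
    have "K = K'" if K: "K \<in> components S" "K \<subseteq> K'" for K
    proof -
      obtain b where "b \<in> K" using component_nonempty[OF K(1)] by blast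
      then show ?thesis using component_unique[OF K(1) aK(1)] K(2) K'C by auto
    qed
    then show ?thesis using aK(1) K'C by auto
  qed
  show "{K \<in> components S. K \<subseteq> K'} = {K \<in> components S. K \<inter> legs e \<noteq> {}}"
    if ne: "K' \<inter> legs e \<noteq> {}"
  proof -
    have K'C: "K' = (contact S)\<^sup>* `` legs e"
      using ne K'_eq by (auto split: if_splits)
    have "K \<subseteq> K' \<longleftrightarrow> K \<inter> legs e \<noteq> {}" if K: "K \<in> components S" for K
    proof
      assume KK': "K \<subseteq> K'"
      obtain b where b: "b \<in> K" using component_nonempty[OF K] by blast
      then obtain l where l: "l \<in> legs e" "(l, b) \<in> (contact S)\<^sup>*" using KK' K'C by auto
      then have "(b, l) \<in> (contact S)\<^sup>*"
        using sym_rtrancl[OF sym_contact] by (auto dest: symD)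
      then have "l \<in> K" using component_eq_class[OF K b] by auto
      with l show "K \<inter> legs e \<noteq> {}" by blast
    next
      assume "K \<inter> legs e \<noteq> {}"
      then obtain l where l: "l \<in> K" "l \<in> legs e" by blast
      then have "K = ?C l" using component_eq_class[OF K] by blast
      then show "K \<subseteq> K'" using l K'C by auto
    qed
    then show ?thesis by blast
  qed
qed

lemma component_in_update:
  assumes e: "e \<in> M" and K: "K \<in> components S"
  shows "\<exists>!K'. K' \<in> components (S(e := Nodal)) \<and> K \<subseteq> K'"
proof -
  obtain b where b: "b \<in> K" using component_nonempty[OF K] by blast
  have bf: "b \<in> free_ends" using b component_subset[OF K] by blast
  let ?K' = "(contact (S(e := Nodal)))\<^sup>* `` {b}"
  have "?K' \<in> components (S(e := Nodal))" using bf by (auto simp: components_eq)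
  moreover have "K \<subseteq> ?K'"
  proof -
    have "(contact S)\<^sup>* \<subseteq> (contact (S(e := Nodal)))\<^sup>*"
      unfolding contact_update[OF e] by (rule rtrancl_mono) auto
    then show ?thesis using component_eq_class[OF K b] by auto
  qed
  moreover have "K'' = ?K'" if "K'' \<in> components (S(e := Nodal))" "K \<subseteq> K''" for K''
    using component_eq_class[OF that(1)] that(2) b by blast
  ultimately show ?thesis by blast
qed

end

section \<open>Labels modulo the square of the variable\<close>

lemma poly_cutoff_mult_right:
  fixes p q :: "'a::comm_semiring_1 poly"
  shows "poly_cutoff n (p * poly_cutoff n q) = poly_cutoff n (p * q)"
  by (auto simp: poly_eq_iff coeff_poly_cutoff coeff_mult intro!: sum.cong)

lemma poly_cutoff_prod:
  fixes f :: "'c \<Rightarrow> 'a::comm_semiring_1 poly"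
  shows "poly_cutoff n (\<Prod>a\<in>A. poly_cutoff n (f a)) = poly_cutoff n (\<Prod>a\<in>A. f a)"
proof (induction A rule: infinite_finite_induct)
  case (insert x A)
  have "poly_cutoff n (poly_cutoff n (f x) * (\<Prod>a\<in>A. poly_cutoff n (f a))) =
      poly_cutoff n (poly_cutoff n (f x) * (\<Prod>a\<in>A. f a))"
    using insert.IH by (metis poly_cutoff_mult_right)
  also have "\<dots> = poly_cutoff n (f x * (\<Prod>a\<in>A. f a))"
    by (metis poly_cutoff_mult_right mult.commute)
  finally show ?case using insert by simp
qed auto

lemma label_x_neq_1 [simp]: "label_x \<noteq> 1" "1 \<noteq> label_x"
  by (simp_all add: one_pCons)

lemma prod_labels:
  assumes "finite A" "\<And>a. a \<in> A \<Longrightarrow> f a \<in> {1, label_x}"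
  shows "prod f A = label_x ^ card {a \<in> A. f a = label_x}"
proof -
  have "prod f A = (\<Prod>a\<in>A. if f a = label_x then label_x else 1)"
    using assms(2) by (intro prod.cong) auto
  also have "\<dots> = label_x ^ card {a \<in> A. f a = label_x}"
    using assms(1) by (simp add: prod.If_cases Int_def)
  finally show ?thesis .
qed

lemma pcompose_monom: "pcompose (monom c n) q = smult c (q ^ n)"
  by (induction n) (simp_all add: monom_0 monom_Suc pcompose_pCons)

lemma smult_sum_right: "smult c (sum f A) = (\<Sum>a\<in>A. smult c (f a))"
  by (induction A rule: infinite_finite_induct) (simp_all add: smult_add_right)

lemma label_x_power: "label_x ^ k = monom 1 k"
  by (simp add: monom_altdef)

lemma poly_cutoff_label_power:
  "poly_cutoff 2 (label_x ^ k) = (if k = 0 then 1 else if k = 1 then label_x else 0)"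
proof (cases "k < 2")
  case True
  then have "poly_cutoff 2 (label_x ^ k) = label_x ^ k"
    unfolding label_x_power by (auto simp: poly_eq_iff coeff_poly_cutoff)
  with True show ?thesis by (auto simp: less_2_cases_iff)
next
  case False
  then have "poly_cutoff 2 (label_x ^ k) = 0"
    unfolding label_x_power by (auto simp: poly_eq_iff coeff_poly_cutoff)
  with False show ?thesis by auto
qed

text \<open>
  The label that a set \<open>K'\<close> receives from a labelling \<open>m\<close> of the sets in \<open>P\<close>: the product modulo
  \<open>x\<^sup>2\<close> of the labels of all members of \<open>P\<close> inside \<open>K'\<close>.
\<close>

definition push_label :: "'b set set \<Rightarrow> ('b set \<Rightarrow> int poly) \<Rightarrow> 'b set \<Rightarrow> int poly" where
  "push_label P m K' = poly_cutoff 2 (\<Prod>K\<in>{K \<in> P. K \<subseteq> K'}. m K)"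

text \<open>
  A nonzero pushed label is \<open>x\<close> or \<open>1\<close> according as one or none of the factors is \<open>x\<close>; hence pushing
  preserves the number of labels \<open>x\<close>.
\<close>

lemma push_label_cases:
  assumes "finite P" "\<And>K. K \<in> P \<Longrightarrow> m K \<in> {1, label_x}"
  shows "push_label P m K' \<in> {0, 1, label_x}"
    and "push_label P m K' \<noteq> 0 \<Longrightarrow>
      card {K \<in> P. K \<subseteq> K' \<and> m K = label_x} = (if push_label P m K' = label_x then 1 else 0)"
proof -
  have "(\<Prod>K\<in>{K \<in> P. K \<subseteq> K'}. m K) = label_x ^ card {K \<in> {K \<in> P. K \<subseteq> K'}. m K = label_x}"
    using assms by (intro prod_labels) auto
  also have "{K \<in> {K \<in> P. K \<subseteq> K'}. m K = label_x} = {K \<in> P. K \<subseteq> K' \<and> m K = label_x}"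
    by auto
  finally have p: "push_label P m K' = (if card {K \<in> P. K \<subseteq> K' \<and> m K = label_x} = 0 then 1
      else if card {K \<in> P. K \<subseteq> K' \<and> m K = label_x} = 1 then label_x else 0)"
    unfolding push_label_def by (simp only: poly_cutoff_label_power)
  show "push_label P m K' \<in> {0, 1, label_x}"
    unfolding p by simp
  show "card {K \<in> P. K \<subseteq> K' \<and> m K = label_x} = (if push_label P m K' = label_x then 1 else 0)"
    if "push_label P m K' \<noteq> 0"
  proof -
    define n where "n = card {K \<in> P. K \<subseteq> K' \<and> m K = label_x}"
    have "push_label P m K' = (if n = 0 then 1 else if n = 1 then label_x else 0)"
      unfolding n_def by (rule p)
    with that have "n = (if push_label P m K' = label_x then 1 else 0)"
      by (cases "n = 0"; cases "n = 1") simp_all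
    then show ?thesis by (simp only: n_def)
  qed
qed

section \<open>Partial differentials as pushing of labels\<close>

context matched_trivalent_graph
begin

text \<open>
  Every component of \<open>S\<close> lies in a component of \<open>S'\<close>.
\<close>

definition coarsens :: "('b set \<Rightarrow> resolution) \<Rightarrow> ('b set \<Rightarrow> resolution) \<Rightarrow> bool" where
  "coarsens S S' \<longleftrightarrow> (\<forall>K\<in>components S. \<exists>K'\<in>components S'. K \<subseteq> K')"

lemma coarsens_update: "e \<in> M \<Longrightarrow> coarsens S (S(e := Nodal))"
  unfolding coarsens_def
proof
  fix K assume "e \<in> M" "K \<in> components S"
  then have "\<exists>!K'. K' \<in> components (S(e := Nodal)) \<and> K \<subseteq> K'"
    by (rule component_in_update)
  then show "\<exists>K'\<in>components (S(e := Nodal)). K \<subseteq> K'" by blast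
qed

lemma coarsens_map:
  assumes "coarsens S S'"
  obtains g where "g ` components S \<subseteq> components S'"
    "\<And>K K'. K \<in> components S \<Longrightarrow> K' \<in> components S' \<Longrightarrow> K \<subseteq> K' \<longleftrightarrow> g K = K'"
proof -
  from assms obtain g where g: "\<forall>K\<in>components S. g K \<in> components S' \<and> K \<subseteq> g K"
    unfolding coarsens_def by metis
  have "K \<subseteq> K' \<longleftrightarrow> g K = K'" if K: "K \<in> components S" "K' \<in> components S'" for K K'
  proof
    assume KK': "K \<subseteq> K'"
    obtain a where a: "a \<in> K" using component_nonempty[OF K(1)] by blast
    show "g K = K'"
      by (rule component_unique[of _ S' _ a]) (use g K KK' a in auto)
  qed (use g K in auto)
  with g that show ?thesis by blast
qed

text \<open>
  Pushing labels is functorial, because reduction modulo \<open>x\<^sup>2\<close> is multiplicative.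
\<close>

lemma push_label_push_label:
  assumes S: "coarsens S S'" "coarsens S' S''" and K'': "K'' \<in> components S''"
  shows "push_label (components S') (restrict (push_label (components S) m) (components S')) K'' =
    push_label (components S) m K''"
proof -
  let ?P = "components S" and ?P' = "components S'"
  obtain g where g: "g ` ?P \<subseteq> ?P'" "\<And>K K'. K \<in> ?P \<Longrightarrow> K' \<in> ?P' \<Longrightarrow> K \<subseteq> K' \<longleftrightarrow> g K = K'"
    using coarsens_map[OF S(1)] by blast
  have gK: "g K \<in> ?P'" "K \<subseteq> g K" if "K \<in> ?P" for K
    using g that by auto
  have le: "K \<subseteq> K'' \<longleftrightarrow> g K \<subseteq> K''" if K: "K \<in> ?P" for K
  proof
    assume KK'': "K \<subseteq> K''"
    obtain L where L: "L \<in> components S''" "g K \<subseteq> L"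
      using S(2) gK[OF K] by (auto simp: coarsens_def)
    obtain a where a: "a \<in> K" using component_nonempty[OF K] by blast
    have "L = K''"
      by (rule component_unique[OF L(1) K'', of a]) (use a L gK[OF K] KK'' in auto)
    with L show "g K \<subseteq> K''" by simp
  qed (use gK[OF K] in blast)
  have "push_label ?P' (restrict (push_label ?P m) ?P') K'' =
      poly_cutoff 2 (\<Prod>K'\<in>{K' \<in> ?P'. K' \<subseteq> K''}. poly_cutoff 2 (\<Prod>K\<in>{K \<in> ?P. K \<subseteq> K'}. m K))"
    unfolding push_label_def by (intro arg_cong[of _ _ "poly_cutoff 2"] prod.cong) auto
  also have "\<dots> = poly_cutoff 2 (\<Prod>K'\<in>{K' \<in> ?P'. K' \<subseteq> K''}. \<Prod>K\<in>{K \<in> ?P. K \<subseteq> K'}. m K)"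
    by (rule poly_cutoff_prod)
  also have "(\<Prod>K'\<in>{K' \<in> ?P'. K' \<subseteq> K''}. \<Prod>K\<in>{K \<in> ?P. K \<subseteq> K'}. m K) =
      (\<Prod>K'\<in>{K' \<in> ?P'. K' \<subseteq> K''}. \<Prod>K\<in>{K \<in> {K \<in> ?P. K \<subseteq> K''}. g K = K'}. m K)"
  proof (rule prod.cong[OF refl])
    fix K' assume K': "K' \<in> {K' \<in> ?P'. K' \<subseteq> K''}"
    then have "{K \<in> ?P. K \<subseteq> K'} = {K \<in> {K \<in> ?P. K \<subseteq> K''}. g K = K'}"
      using g(2) by blast
    then show "(\<Prod>K\<in>{K \<in> ?P. K \<subseteq> K'}. m K) = (\<Prod>K\<in>{K \<in> {K \<in> ?P. K \<subseteq> K''}. g K = K'}. m K)"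
      by (rule prod.cong) auto
  qed
  also have "\<dots> = (\<Prod>K\<in>{K \<in> ?P. K \<subseteq> K''}. m K)"
    by (rule prod.group) (use gK le in auto)
  finally show ?thesis unfolding push_label_def[of ?P m K''] .
qed

lemma sum_over_components:
  assumes "coarsens S S'"
  shows "(\<Sum>K'\<in>components S'. \<Sum>K\<in>{K \<in> components S. K \<subseteq> K'}. h K) = (\<Sum>K\<in>components S. h K)"
proof -
  obtain g where g: "g ` components S \<subseteq> components S'"
    "\<And>K K'. K \<in> components S \<Longrightarrow> K' \<in> components S' \<Longrightarrow> K \<subseteq> K' \<longleftrightarrow> g K = K'"
    using coarsens_map[OF assms] by blast
  have "(\<Sum>K'\<in>components S'. \<Sum>K\<in>{K \<in> components S. K \<subseteq> K'}. h K) =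
      (\<Sum>K'\<in>components S'. \<Sum>K\<in>{K \<in> components S. g K = K'}. h K)"
    using g(2) by (intro sum.cong refl) auto
  also have "\<dots> = (\<Sum>K\<in>components S. h K)"
    by (rule sum.group) (use g(1) in auto)
  finally show ?thesis .
qed

text \<open>
  The label of the nodal crossing that replaces the resolution of the site \<open>e\<close> in \<open>S\<close>. It depends
  only on \<open>S e\<close>, so changing another site does not affect it.
\<close>

definition site_label :: "('b set \<Rightarrow> resolution) \<Rightarrow> 'b set \<Rightarrow> nat" where
  "site_label S e = (if S e = Parallel then 0 else 1)"

text \<open>
  The enhanced state on \<open>S'\<close> with crossing labels \<open>u'\<close> and with the component labels pushed from
  \<open>S\<close>, or zero if some pushed label vanishes.
\<close>

definition pushed :: "('b set \<Rightarrow> resolution) \<Rightarrow> ('b set \<Rightarrow> int poly) \<Rightarrow>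
    ('b set \<Rightarrow> resolution) \<Rightarrow> ('b set \<Rightarrow> nat) \<Rightarrow> 'b enhanced_state \<Rightarrow>\<^sub>0 int" where
  "pushed S m S' u' =
     (if \<exists>K'\<in>components S'. push_label (components S) m K' = 0 then 0
      else frag_of (S', u', restrict (push_label (components S) m) (components S')))"

lemma partial_diff_eq_pushed:
  assumes e: "e \<in> M" and m: "m \<in> components S \<rightarrow>\<^sub>E {1, label_x}"
  shows "partial_diff e (S, u, m) = pushed S m (S(e := Nodal)) (u(e := site_label S e))"
proof -
  let ?S' = "S(e := Nodal)" and ?p = "joined_label S m e" and ?q = "push_label (components S) m"
  have away: "?q K' = m K'" "m K' \<noteq> 0" if K': "K' \<in> components ?S'" "K' \<inter> legs e = {}" for K'
  proof -
    have eq: "{K \<in> components S. K \<subseteq> K'} = {K'}"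
      by (rule component_update(1)[OF e K'])
    then have "m K' \<in> {1, label_x}" using m by auto
    then have "poly_cutoff 2 (m K') = m K'" "m K' \<noteq> 0"
      using poly_cutoff_label_power[of 1] by auto
    then show "?q K' = m K'" "m K' \<noteq> 0" by (simp_all add: push_label_def eq)
  qed
  have near: "?q K' = ?p" if "K' \<in> components ?S'" "K' \<inter> legs e \<noteq> {}" for K'
    unfolding push_label_def joined_label_def component_update(2)[OF e that] ..
  have labels: "restrict (\<lambda>K. if K \<inter> legs e = {} then m K else ?p) (components ?S') =
      restrict ?q (components ?S')"
    using away near by (intro restrict_ext) auto
  have zero: "?p = 0 \<longleftrightarrow> (\<exists>K'\<in>components ?S'. ?q K' = 0)"
  proof
    assume p: "?p = 0"
    have "{K \<in> components S. K \<inter> legs e \<noteq> {}} \<noteq> {}"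
    proof
      assume "{K \<in> components S. K \<inter> legs e \<noteq> {}} = {}"
      then have "?p = 1" unfolding joined_label_def by (simp only:) simp
      with p show False by simp
    qed
    then obtain K where K: "K \<in> components S" "K \<inter> legs e \<noteq> {}" by blast
    then obtain K' where K': "K' \<in> components ?S'" "K \<subseteq> K'"
      using component_in_update[OF e] by blast
    have "K' \<inter> legs e \<noteq> {}" using K K' by blast
    from near[OF K'(1) this] p K'(1) show "\<exists>K'\<in>components ?S'. ?q K' = 0" by auto
  next
    assume "\<exists>K'\<in>components ?S'. ?q K' = 0"
    then obtain K' where K': "K' \<in> components ?S'" "?q K' = 0" by blast
    with away[OF K'(1)] have "K' \<inter> legs e \<noteq> {}" by auto
    with near[OF K'(1)] K' show "?p = 0" by simp
  qed
  show ?thesis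
    unfolding partial_diff_def pushed_def Let_def prod.case labels zero site_label_def ..
qed

lemma pushed_labels:
  assumes m: "m \<in> components S \<rightarrow>\<^sub>E {1, label_x}"
    and ne: "\<not> (\<exists>K'\<in>components S'. push_label (components S) m K' = 0)"
  shows "restrict (push_label (components S) m) (components S') \<in> components S' \<rightarrow>\<^sub>E {1, label_x}"
proof (rule restrict_PiE_iff[THEN iffD2], rule ballI)
  fix K' assume "K' \<in> components S'"
  moreover have "push_label (components S) m K' \<in> {0, 1, label_x}"
    by (rule push_label_cases) (use m in auto)
  ultimately show "push_label (components S) m K' \<in> {1, label_x}" using ne by auto
qed

text \<open>
  The right-hand side is symmetric in \<open>e\<close> and \<open>f\<close>: two partial differentials amount to one push
  along the composite coarsening. If the first one vanishes, then so does the label of the component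
  of the last state that contains the component with label zero.
\<close>

lemma partial_diff_partial_diff:
  assumes ef: "e \<in> M" "f \<in> M" "e \<noteq> f" and m: "m \<in> components S \<rightarrow>\<^sub>E {1, label_x}"
  shows "frag_extend (partial_diff f) (partial_diff e (S, u, m)) =
    pushed S m (S(e := Nodal, f := Nodal)) (u(e := site_label S e, f := site_label S f))"
proof -
  let ?S' = "S(e := Nodal)" and ?S'' = "S(e := Nodal, f := Nodal)"
  let ?q = "push_label (components S) m"
  let ?m' = "restrict ?q (components ?S')"
  have c: "coarsens S ?S'" "coarsens ?S' ?S''" using coarsens_update ef by auto
  have pp: "push_label (components ?S') ?m' K'' = ?q K''" if "K'' \<in> components ?S''" for K''
    by (rule push_label_push_label[OF c that])
  show ?thesis
  proof (cases "\<exists>K'\<in>components ?S'. ?q K' = 0")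
    case True
    then obtain K' where K': "K' \<in> components ?S'" "?q K' = 0" by blast
    then obtain K'' where K'': "K'' \<in> components ?S''" "K' \<subseteq> K''"
      using c(2) by (auto simp: coarsens_def)
    have "(\<Prod>K\<in>{K \<in> components ?S'. K \<subseteq> K''}. ?m' K) = 0"
      by (rule prod_zero) (use K' K'' in auto)
    then have "push_label (components ?S') ?m' K'' = 0"
      unfolding push_label_def[of "components ?S'"] by (simp only: poly_cutoff_0)
    then have "?q K'' = 0" using pp[OF K''(1)] by (simp only:)
    then have "pushed S m ?S'' u'' = 0" for u'' using K''(1) by (auto simp: pushed_def)
    moreover have "partial_diff e (S, u, m) = 0"
      using True by (simp add: partial_diff_eq_pushed[OF ef(1) m] pushed_def)
    ultimately show ?thesis by simp
  next
    case False
    have m': "?m' \<in> components ?S' \<rightarrow>\<^sub>E {1, label_x}"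
      by (rule pushed_labels[OF m False])
    have "partial_diff e (S, u, m) = frag_of (?S', u(e := site_label S e), ?m')"
      using False by (simp add: partial_diff_eq_pushed[OF ef(1) m] pushed_def)
    then have "frag_extend (partial_diff f) (partial_diff e (S, u, m)) =
        pushed ?S' ?m' ?S'' (u(e := site_label S e, f := site_label ?S' f))"
      by (simp add: partial_diff_eq_pushed[OF ef(2) m'])
    also have "site_label ?S' f = site_label S f" using ef(3) by (simp add: site_label_def)
    also have "pushed ?S' ?m' ?S'' u'' = pushed S m ?S'' u''" for u''
    proof -
      have "restrict (push_label (components ?S') ?m') (components ?S'') =
          restrict ?q (components ?S'')"
        using pp by (rule restrict_ext)
      moreover have "(\<exists>K''\<in>components ?S''. push_label (components ?S') ?m' K'' = 0) \<longleftrightarrow>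
          (\<exists>K''\<in>components ?S''. ?q K'' = 0)"
        using pp by (intro bex_cong) auto
      ultimately show ?thesis by (simp only: pushed_def)
    qed
    finally show ?thesis .
  qed
qed

lemma partial_diff_commute:
  assumes "e \<in> M" "f \<in> M" "e \<noteq> f" "s \<in> enhanced_states"
  shows "frag_extend (partial_diff f) (partial_diff e s) =
    frag_extend (partial_diff e) (partial_diff f s)"
proof -
  obtain S u m where s: "s = (S, u, m)" by (cases s)
  then have m: "m \<in> components S \<rightarrow>\<^sub>E {1, label_x}" using assms(4) by (simp add: enhanced_states_def)
  have "S(e := Nodal, f := Nodal) = S(f := Nodal, e := Nodal)"
    "u(e := site_label S e, f := site_label S f) = u(f := site_label S f, e := site_label S e)"
    using assms(3) by (auto simp: fun_upd_twist)
  then show ?thesis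
    unfolding s using assms(1-3)
    by (simp add: partial_diff_partial_diff[OF _ _ _ m])
qed

lemma x_degree_sum: "x_degree (S, u, m) = (\<Sum>K\<in>components S. if m K = label_x then 1 else 0)"
  by (simp add: x_degree_def sum.If_cases Int_def)

lemma partial_diff_cases:
  assumes s: "s \<in> enhanced_states" and e: "e \<in> M - nodal_sites (fst s)"
  obtains "partial_diff e s = 0"
  | t where "partial_diff e s = frag_of t" "t \<in> enhanced_states" "fst t = (fst s)(e := Nodal)"
      "hom_degree t = Suc (hom_degree s)" "x_degree t = x_degree s"
proof -
  obtain S u m where s': "s = (S, u, m)" by (cases s)
  then have S: "S \<in> states" and u: "u \<in> nodal_sites S \<rightarrow>\<^sub>E {0, 1}"
    and m: "m \<in> components S \<rightarrow>\<^sub>E {1, label_x}"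
    using s by (auto simp: enhanced_states_def)
  have eM: "e \<in> M" "e \<notin> nodal_sites S" using e s' by auto
  let ?S' = "S(e := Nodal)" and ?q = "push_label (components S) m"
  let ?u' = "u(e := site_label S e)" and ?m' = "restrict ?q (components ?S')"
  show ?thesis
  proof (cases "\<exists>K'\<in>components ?S'. ?q K' = 0")
    case True
    then show ?thesis
      using that(1) by (simp add: s' partial_diff_eq_pushed[OF eM(1) m] pushed_def)
  next
    case False
    have nodal: "nodal_sites ?S' = insert e (nodal_sites S)"
      using eM(1) by (auto simp: nodal_sites_def)
    have "?S' \<in> states"
      using S eM(1) PiE_fun_upd[of Nodal "\<lambda>_. UNIV" e S M] by (simp add: states_def insert_absorb)
    moreover have "?u' \<in> nodal_sites ?S' \<rightarrow>\<^sub>E {0, 1}"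
      unfolding nodal using u by (intro PiE_fun_upd) (auto simp: site_label_def)
    moreover have m': "?m' \<in> components ?S' \<rightarrow>\<^sub>E {1, label_x}"
      by (rule pushed_labels[OF m False])
    ultimately have t: "(?S', ?u', ?m') \<in> enhanced_states" by (simp add: enhanced_states_def)
    have "finite (nodal_sites S)" using finite_M by (simp add: nodal_sites_def)
    then have h: "hom_degree (?S', ?u', ?m') = Suc (hom_degree s)"
      using eM(2) by (simp add: s' hom_degree_def num_nodal_def nodal)
    have "x_degree (?S', ?u', ?m') =
        (\<Sum>K'\<in>components ?S'. \<Sum>K\<in>{K \<in> components S. K \<subseteq> K'}. if m K = label_x then 1 else 0)"
      unfolding x_degree_sum
    proof (rule sum.cong[OF refl])
      fix K' assume K': "K' \<in> components ?S'"
      have "card {K \<in> components S. K \<subseteq> K' \<and> m K = label_x} = (if ?q K' = label_x then 1 else 0)"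
        by (rule push_label_cases(2)) (use m False K' in auto)
      moreover have "(\<Sum>K\<in>{K \<in> components S. K \<subseteq> K'}. if m K = label_x then 1 else 0) =
          card {K \<in> components S. K \<subseteq> K' \<and> m K = label_x}"
        by (simp add: sum.If_cases Int_def conj_assoc)
      ultimately show "(if ?m' K' = label_x then 1 else 0 :: nat) =
          (\<Sum>K\<in>{K \<in> components S. K \<subseteq> K'}. if m K = label_x then 1 else 0)"
        by (simp only: restrict_apply'[OF K'])
    qed
    also have "\<dots> = x_degree s"
      unfolding s' x_degree_sum by (rule sum_over_components[OF coarsens_update[OF eM(1)]])
    finally have x: "x_degree (?S', ?u', ?m') = x_degree s" .
    have "partial_diff e s = frag_of (?S', ?u', ?m')"
      using False by (simp add: s' partial_diff_eq_pushed[OF eM(1) m] pushed_def)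
    then show ?thesis by (rule that(2)) (use t h x in \<open>simp_all add: s'\<close>)
  qed
qed

section \<open>The differential squares to zero\<close>

text \<open>
  The enhanced states that freely generate the chain group of bidegree \<open>(k, j)\<close>.
\<close>

definition generators :: "nat \<Rightarrow> nat \<Rightarrow> 'b enhanced_state set" where
  "generators k j = {s \<in> enhanced_states. hom_degree s = k \<and> x_degree s = j}"

lemma chain_grp_eq: "chain_grp k j = free_Abelian_group (generators k j)"
  by (simp add: chain_grp_def generators_def)

lemma diff_frag_of:
  "diff (frag_of s) = (\<Sum>e\<in>M - nodal_sites (fst s).
     frag_cmul ((- 1) ^ card (preceding_sites e s)) (partial_diff e s))"
  by (simp add: diff_def)

lemma diff_generators:
  assumes "Poly_Mapping.keys c \<subseteq> generators k j"
  shows "Poly_Mapping.keys (diff c) \<subseteq> generators (Suc k) j"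
  using assms
proof (induction c rule: free_Abelian_group_induct[consumes 1])
  case 1
  show ?case by (simp add: diff_def)
next
  case (2 x y)
  have "Poly_Mapping.keys (diff (x - y)) \<subseteq> Poly_Mapping.keys (diff x) \<union> Poly_Mapping.keys (diff y)"
    unfolding diff_def frag_extend_diff by (rule keys_diff)
  with 2 show ?case by blast
next
  case (3 s)
  show ?case
    unfolding diff_frag_of
  proof (rule order_trans[OF keys_sum], rule UN_least)
    fix e assume e: "e \<in> M - nodal_sites (fst s)"
    have s: "s \<in> enhanced_states" "hom_degree s = k" "x_degree s = j"
      using 3 by (auto simp: generators_def)
    show "Poly_Mapping.keys (frag_cmul ((- 1) ^ card (preceding_sites e s)) (partial_diff e s))
        \<subseteq> generators (Suc k) j"
      by (rule partial_diff_cases[OF s(1) e]) (use s in \<open>auto simp: generators_def\<close>)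
  qed
qed

text \<open>
  The sign of the partial differential at the site \<open>f\<close> when \<open>N\<close> is the set of non-nodal sites.
\<close>

definition site_sign :: "'b set set \<Rightarrow> 'b set \<Rightarrow> int" where
  "site_sign N f = (- 1) ^ card {e \<in> N. e \<noteq> f \<and> (e, f) \<in> r}"

lemma site_sign_preceding: "(- 1) ^ card (preceding_sites e s) = site_sign (M - nodal_sites (fst s)) e"
  by (cases s) (simp add: preceding_sites_def site_sign_def)

lemma site_sign_remove:
  assumes "finite N" "e \<in> N" "e \<noteq> f"
  shows "site_sign (N - {e}) f = (if (e, f) \<in> r then - site_sign N f else site_sign N f)"
proof -
  have eq: "{e' \<in> N - {e}. e' \<noteq> f \<and> (e', f) \<in> r} = {e' \<in> N. e' \<noteq> f \<and> (e', f) \<in> r} - {e}"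
    by auto
  show ?thesis
  proof (cases "(e, f) \<in> r")
    case True
    then have "card {e' \<in> N. e' \<noteq> f \<and> (e', f) \<in> r} =
        Suc (card ({e' \<in> N. e' \<noteq> f \<and> (e', f) \<in> r} - {e}))"
      using assms by (intro card.remove) auto
    then have "site_sign N f = - site_sign (N - {e}) f"
      unfolding site_sign_def eq by (simp only: power_Suc mult_minus_left mult_1)
    then show ?thesis using True by simp
  next
    case False
    then have "{e' \<in> N. e' \<noteq> f \<and> (e', f) \<in> r} - {e} = {e' \<in> N. e' \<noteq> f \<and> (e', f) \<in> r}"
      by blast
    then have "site_sign (N - {e}) f = site_sign N f"
      unfolding site_sign_def eq by (simp only:)
    then show ?thesis using False by simp
  qed
qed

text \<open>
  Operating on \<open>e\<close> first changes the sign at \<open>f\<close> if and only if \<open>e\<close> precedes \<open>f\<close>, and in a linear order exactly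
  one of two distinct sites precedes the other.
\<close>

lemma site_sign_antisym:
  assumes N: "N \<subseteq> M" and ef: "e \<in> N" "f \<in> N" "e \<noteq> f"
  shows "site_sign N e * site_sign (N - {e}) f = - (site_sign N f * site_sign (N - {f}) e)"
proof -
  have fin: "finite N" using N finite_M by (rule finite_subset)
  have "(e, f) \<in> r \<longleftrightarrow> (f, e) \<notin> r"
    using site_order N ef unfolding linear_order_on_def partial_order_on_def total_on_def antisym_def
    by blast
  then show ?thesis
    using site_sign_remove[OF fin ef(1,3)] site_sign_remove[OF fin ef(2) ef(3)[symmetric]]
    by auto
qed

lemma frag_eq_uminus:
  fixes x :: "'e \<Rightarrow>\<^sub>0 int"
  assumes "x = - x"
  shows "x = 0"
proof (rule poly_mapping_eqI)
  fix t
  have "Poly_Mapping.lookup x t = Poly_Mapping.lookup (- x) t"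
    using assms by (rule arg_cong)
  then show "Poly_Mapping.lookup x t = Poly_Mapping.lookup 0 t" by simp
qed

lemma frag_antisym_sum:
  fixes D :: "'i \<Rightarrow> 'i \<Rightarrow> ('e \<Rightarrow>\<^sub>0 int)"
  assumes anti: "\<And>e f. e \<in> N \<Longrightarrow> f \<in> N \<Longrightarrow> e \<noteq> f \<Longrightarrow> D e f = - D f e" and fin: "finite N"
  shows "(\<Sum>e\<in>N. \<Sum>f\<in>N - {e}. D e f) = 0"
proof -
  define E where "E e f = (if e = f then 0 else D e f)" for e f
  have E: "(\<Sum>e\<in>N. \<Sum>f\<in>N - {e}. D e f) = (\<Sum>e\<in>N. \<Sum>f\<in>N. E e f)"
    using fin by (intro sum.cong sum.mono_neutral_cong_left) (auto simp: E_def)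
  also have "\<dots> = (\<Sum>f\<in>N. \<Sum>e\<in>N. E e f)"
    by (rule sum.swap)
  also have "\<dots> = (\<Sum>f\<in>N. \<Sum>e\<in>N. - E f e)"
  proof (intro sum.cong refl)
    fix f e assume "f \<in> N" "e \<in> N"
    then show "E e f = - E f e"
      using anti[of e f] by (cases "e = f") (simp_all add: E_def)
  qed
  also have "\<dots> = - (\<Sum>e\<in>N. \<Sum>f\<in>N - {e}. D e f)"
    by (simp only: sum_negf E)
  finally have "(\<Sum>e\<in>N. \<Sum>f\<in>N - {e}. D e f) = - (\<Sum>e\<in>N. \<Sum>f\<in>N - {e}. D e f)" .
  then show ?thesis by (rule frag_eq_uminus)
qed

lemma diff_partial_diff:
  assumes s: "s \<in> enhanced_states" and e: "e \<in> M - nodal_sites (fst s)"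
  shows "diff (partial_diff e s) = (\<Sum>f\<in>M - nodal_sites (fst s) - {e}.
    frag_cmul (site_sign (M - nodal_sites (fst s) - {e}) f)
      (frag_extend (partial_diff f) (partial_diff e s)))"
proof (rule partial_diff_cases[OF s e])
  fix t assume t: "partial_diff e s = frag_of t" "fst t = (fst s)(e := Nodal)"
  have "M - nodal_sites (fst t) = M - nodal_sites (fst s) - {e}"
    unfolding t(2) by (auto simp: nodal_sites_def)
  then show ?thesis
    by (simp add: t(1) diff_frag_of site_sign_preceding)
qed (simp add: diff_def)

lemma diff_diff:
  assumes "Poly_Mapping.keys c \<subseteq> generators k j"
  shows "diff (diff c) = 0"
  using assms
proof (induction c rule: free_Abelian_group_induct[consumes 1])
  case 1
  show ?case by (simp add: diff_def)
next
  case (2 x y)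
  then show ?case by (simp add: diff_def frag_extend_diff)
next
  case (3 s)
  then have s: "s \<in> enhanced_states" by (simp add: generators_def)
  let ?N = "M - nodal_sites (fst s)"
  define D where "D e f = frag_cmul (site_sign ?N e * site_sign (?N - {e}) f)
      (frag_extend (partial_diff f) (partial_diff e s))" for e f
  have fin: "finite ?N" using finite_M by simp
  have "diff (diff (frag_of s)) =
      (\<Sum>e\<in>?N. frag_cmul (site_sign ?N e) (diff (partial_diff e s)))"
    unfolding diff_frag_of site_sign_preceding
    unfolding diff_def by (simp add: frag_extend_sum[OF fin] frag_extend_cmul o_def)
  also have "\<dots> = (\<Sum>e\<in>?N. \<Sum>f\<in>?N - {e}. D e f)"
    by (intro sum.cong refl) (simp add: diff_partial_diff[OF s] frag_cmul_sum D_def)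
  also have "\<dots> = 0"
  proof (rule frag_antisym_sum[OF _ fin])
    fix e f assume ef: "e \<in> ?N" "f \<in> ?N" "e \<noteq> f"
    have "D e f = frag_cmul (- (site_sign ?N f * site_sign (?N - {f}) e))
        (frag_extend (partial_diff f) (partial_diff e s))"
      unfolding D_def by (subst site_sign_antisym) (use ef in auto)
    also have "frag_extend (partial_diff f) (partial_diff e s) =
        frag_extend (partial_diff e) (partial_diff f s)"
      by (rule partial_diff_commute) (use ef s in auto)
    finally show "D e f = - D f e" by (simp add: D_def)
  qed
  finally show ?case .
qed

section \<open>Ranks of the homology groups and the Euler characteristic\<close>

lemma finite_states: "finite states"
  unfolding states_def using finite_M
  by (intro finite_PiE) (auto intro: finite_subset[of _ "{Parallel, Crossed, Nodal}"] resolution.exhaust)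

lemma finite_nodal_sites: "finite (nodal_sites S)"
  using finite_M by (simp add: nodal_sites_def)

lemma finite_enhanced_states: "finite enhanced_states"
proof -
  have "enhanced_states =
      (SIGMA S:states. (nodal_sites S \<rightarrow>\<^sub>E {0, 1}) \<times> (components S \<rightarrow>\<^sub>E {1, label_x}))"
    by (auto simp: enhanced_states_def)
  also have "finite \<dots>"
    by (intro finite_SigmaI finite_states finite_cartesian_product finite_PiE finite_nodal_sites) auto
  finally show ?thesis .
qed

lemma finite_generators: "finite (generators k j)"
  using finite_enhanced_states by (auto simp: generators_def)

lemma hom_degree_le: "s \<in> enhanced_states \<Longrightarrow> hom_degree s \<le> card M"
  using finite_M by (auto simp: hom_degree_def num_nodal_def nodal_sites_def enhanced_states_def
      intro!: card_mono)

lemma generators_empty: "card M < k \<Longrightarrow> generators k j = {}"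
  using hom_degree_le by (fastforce simp: generators_def)

text \<open>
  The elements of the chain group, as a set.
\<close>

definition chains :: "nat \<Rightarrow> nat \<Rightarrow> ('b enhanced_state \<Rightarrow>\<^sub>0 int) set" where
  "chains k j = {c. Poly_Mapping.keys c \<subseteq> generators k j}"

lemma carrier_chain_grp: "carrier (chain_grp k j) = chains k j"
  by (auto simp: chain_grp_eq chains_def)

lemma frag_subgroup_chains: "frag_subgroup (chains k j)"
proof (rule frag_subgroupI)
  fix x y assume "x \<in> chains k j" "y \<in> chains k j"
  then show "x - y \<in> chains k j"
    using keys_diff[of x y] unfolding chains_def by blast
qed (simp add: chains_def)

lemma cycles_eq: "cycles k j = {c \<in> chains k j. diff c = 0}"
  unfolding cycles_def kernel_def carrier_chain_grp by (simp add: chain_grp_eq)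

lemma boundaries_Suc: "boundaries (Suc k) j = diff ` chains k j"
  by (simp add: boundaries_def carrier_chain_grp)

lemma subgroup_of_chain_grp:
  assumes "X \<subseteq> chains k j" "0 \<in> X" "\<And>x y. x \<in> X \<Longrightarrow> y \<in> X \<Longrightarrow> x - y \<in> X"
  shows "subgroup X (free_Abelian_group (generators k j))"
proof -
  have X: "frag_subgroup X" by (rule frag_subgroupI) fact+
  have keys: "Poly_Mapping.keys x \<subseteq> generators k j" if "x \<in> X" for x
    using assms(1) that by (auto simp: chains_def)
  show ?thesis
  proof (rule group.subgroupI[OF group_free_Abelian_group])
    show "X \<subseteq> carrier (free_Abelian_group (generators k j))" using keys by auto
    show "X \<noteq> {}" using assms(2) by blast
    show "inv\<^bsub>free_Abelian_group (generators k j)\<^esub> x \<in> X" if "x \<in> X" for x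
      using frag_subgroup_minus[OF X that] keys[OF that] by simp
    show "x \<otimes>\<^bsub>free_Abelian_group (generators k j)\<^esub> y \<in> X" if "x \<in> X" "y \<in> X" for x y
      using frag_subgroup_add[OF X that] by simp
  qed
qed

lemma subgroup_cycles: "subgroup (cycles k j) (free_Abelian_group (generators k j))"
  unfolding cycles_eq
  by (rule subgroup_of_chain_grp)
     (auto simp: diff_def frag_extend_diff frag_subgroup_0[OF frag_subgroup_chains]
        frag_subgroup_diff[OF frag_subgroup_chains])

lemma boundaries_subset_cycles: "boundaries k j \<subseteq> cycles k j"
proof (cases k)
  case 0
  then show ?thesis by (simp add: boundaries_def cycles_eq chains_def diff_def)
next
  case (Suc i)
  have "diff c \<in> cycles (Suc i) j" if "c \<in> chains i j" for c
    using that diff_generators diff_diff unfolding cycles_eq chains_def by blast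
  then show ?thesis unfolding Suc boundaries_Suc by blast
qed

lemma subgroup_boundaries: "subgroup (boundaries k j) (free_Abelian_group (generators k j))"
proof (rule subgroup_of_chain_grp)
  show "boundaries k j \<subseteq> chains k j"
    using boundaries_subset_cycles by (auto simp: cycles_eq)
  show "0 \<in> boundaries k j"
  proof (cases k)
    case (Suc i)
    have "diff 0 \<in> boundaries (Suc i) j"
      unfolding boundaries_Suc by (rule imageI) (simp add: chains_def)
    then show ?thesis by (simp add: Suc diff_def)
  qed (simp add: boundaries_def)
  fix x y assume xy: "x \<in> boundaries k j" "y \<in> boundaries k j"
  show "x - y \<in> boundaries k j"
  proof (cases k)
    case 0
    with xy show ?thesis by (simp add: boundaries_def)
  next
    case (Suc i)
    with xy obtain a b where "a \<in> chains i j" "b \<in> chains i j" "x = diff a" "y = diff b"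
      by (auto simp: boundaries_Suc)
    then have "x - y = diff (a - b)" "a - b \<in> chains i j"
      using frag_subgroup_diff[OF frag_subgroup_chains] by (auto simp: diff_def frag_extend_diff)
    then show ?thesis unfolding Suc boundaries_Suc by blast
  qed
qed

lemma rank_homology:
  "int (abelian_rank (homology_grp k j)) = int (frag_rank (cycles k j)) - int (frag_rank (boundaries k j))"
proof -
  have "abelian_rank (homology_grp k j) = frag_rank (cycles k j) - frag_rank (boundaries k j)"
    unfolding homology_grp_def chain_grp_eq
    by (rule abelian_rank_quotient[OF finite_generators subgroup_cycles subgroup_boundaries
          boundaries_subset_cycles])
  moreover have "frag_rank (boundaries k j) \<le> frag_rank (cycles k j)"
    by (rule frag_rank_mono[OF boundaries_subset_cycles finite_generators[of k j]])
       (auto simp: cycles_eq chains_def)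
  ultimately show ?thesis by simp
qed

lemma card_generators:
  "card (generators k j) = frag_rank (cycles k j) + frag_rank (boundaries (Suc k) j)"
proof -
  have "frag_rank (chains k j) = frag_rank {c \<in> chains k j. diff c = 0} + frag_rank (diff ` chains k j)"
    unfolding diff_def
  proof (rule frag_rank_kernel_image[OF frag_subgroup_chains finite_generators[of k j] _
        finite_generators[of "Suc k" j]])
    fix c assume c: "c \<in> chains k j"
    then show "Poly_Mapping.keys c \<subseteq> generators k j" by (simp add: chains_def)
    then show "Poly_Mapping.keys (frag_extend (\<lambda>s. \<Sum>e\<in>M - nodal_sites (fst s).
        frag_cmul ((- 1) ^ card (preceding_sites e s)) (partial_diff e s)) c) \<subseteq> generators (Suc k) j"
      using diff_generators unfolding diff_def by blast
  qed
  then show ?thesis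
    unfolding cycles_eq boundaries_Suc chains_def
    by (simp add: frag_rank_free[OF finite_generators])
qed

lemma frag_rank_boundaries_0: "frag_rank (boundaries 0 j) = 0"
  by (simp add: boundaries_def)

text \<open>
  The ranks of the boundaries telescope. Only the top one remains.
\<close>

lemma alternating_rank_homology:
  "(\<Sum>k\<le>n. (- 1) ^ k * int (abelian_rank (homology_grp k j))) =
   (\<Sum>k\<le>n. (- 1) ^ k * int (card (generators k j))) - (- 1) ^ n * int (frag_rank (boundaries (Suc n) j))"
proof (induction n)
  case 0
  show ?case by (simp add: rank_homology card_generators frag_rank_boundaries_0)
next
  case (Suc n)
  then show ?case by (simp add: rank_homology card_generators algebra_simps)
qed

lemma ranks_above_card:
  assumes "card M < k"
  shows "abelian_rank (homology_grp k j) = 0" "frag_rank (boundaries k j) = 0"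
proof -
  have "frag_rank (cycles k j) = 0"
    using card_generators[of k j] generators_empty[OF assms, of j] by simp
  with rank_homology[of k j]
  show "abelian_rank (homology_grp k j) = 0" "frag_rank (boundaries k j) = 0" by auto
qed

lemma euler_char_eq: "euler_char j = (\<Sum>s\<in>{s \<in> enhanced_states. x_degree s = j}. (- 1) ^ hom_degree s)"
proof -
  have "euler_char j = (\<Sum>k\<le>card M. (- 1) ^ k * int (abelian_rank (homology_grp k j)))"
    unfolding euler_char_def
  proof (rule Sum_any.expand_superset)
    show "{k. (- 1) ^ k * int (abelian_rank (homology_grp k j)) \<noteq> 0} \<subseteq> {..card M}"
    proof
      fix k assume "k \<in> {k. (- 1) ^ k * int (abelian_rank (homology_grp k j)) \<noteq> 0}"
      then show "k \<in> {..card M}"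
        using ranks_above_card(1)[of k j] by (cases "card M < k") simp_all
    qed
  qed simp
  also have "\<dots> = (\<Sum>k\<le>card M. (- 1) ^ k * int (card (generators k j)))"
    by (simp add: alternating_rank_homology ranks_above_card(2))
  also have "\<dots> = (\<Sum>k\<le>card M. \<Sum>s\<in>generators k j. (- 1) ^ hom_degree s)"
    by (simp add: generators_def mult.commute)
  also have "\<dots> = (\<Sum>k\<le>card M. \<Sum>s\<in>{s \<in> {s \<in> enhanced_states. x_degree s = j}. hom_degree s = k}.
      (- 1) ^ hom_degree s)"
    by (intro sum.cong refl) (auto simp: generators_def)
  also have "\<dots> = (\<Sum>s\<in>{s \<in> enhanced_states. x_degree s = j}. (- 1) ^ hom_degree s)"
    by (rule sum.group) (use finite_enhanced_states hom_degree_le in auto)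
  finally show ?thesis .
qed

section \<open>Both sides as a sum over enhanced states\<close>

lemma euler_polynomial:
  "Sum_any (\<lambda>j. monom (euler_char j) j) =
    (\<Sum>s\<in>enhanced_states. monom ((- 1) ^ hom_degree s) (x_degree s))"
proof -
  have fin: "finite (x_degree ` enhanced_states)" using finite_enhanced_states by simp
  have "Sum_any (\<lambda>j. monom (euler_char j) j) = (\<Sum>j\<in>x_degree ` enhanced_states. monom (euler_char j) j)"
  proof (rule Sum_any.expand_superset[OF fin], rule subsetI)
    fix j assume "j \<in> {j. monom (euler_char j) j \<noteq> 0}"
    then have "euler_char j \<noteq> 0" by auto
    then have "{s \<in> enhanced_states. x_degree s = j} \<noteq> {}"
      unfolding euler_char_eq by (metis sum.empty)
    then show "j \<in> x_degree ` enhanced_states" by auto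
  qed
  also have "\<dots> = (\<Sum>j\<in>x_degree ` enhanced_states. \<Sum>s\<in>{s \<in> enhanced_states. x_degree s = j}.
      monom ((- 1) ^ hom_degree s) (x_degree s))"
    unfolding euler_char_eq by (intro sum.cong refl) (simp add: monom_sum)
  also have "\<dots> = (\<Sum>s\<in>enhanced_states. monom ((- 1) ^ hom_degree s) (x_degree s))"
    by (rule sum.group) (use finite_enhanced_states in auto)
  finally show ?thesis .
qed

text \<open>
  Each nodal crossing has two labels, which gives the powers of two; each component has the labels
  \<open>1\<close> and \<open>x\<close>, which gives \<open>(1 + q)\<^sup>c\<close> when \<open>x\<close> is read as \<open>q\<close>.
\<close>

lemma PK_enhanced_states:
  "pcompose PK [:1, 1:] = (\<Sum>s\<in>enhanced_states. monom ((- 1) ^ hom_degree s) (x_degree s))"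
proof -
  have labels: "(\<Sum>m\<in>components S \<rightarrow>\<^sub>E {1, label_x}. monom (1::int) (x_degree (S, u, m))) =
      [:1, 1:] ^ num_components S" for S u
  proof -
    have "(\<Sum>m\<in>components S \<rightarrow>\<^sub>E {1, label_x}. monom (1::int) (x_degree (S, u, m))) =
        (\<Sum>m\<in>components S \<rightarrow>\<^sub>E {1, label_x}. \<Prod>K\<in>components S. m K)"
    proof (rule sum.cong[OF refl])
      fix m assume "m \<in> components S \<rightarrow>\<^sub>E {1, label_x}"
      then have "(\<Prod>K\<in>components S. m K) = label_x ^ card {K \<in> components S. m K = label_x}"
        by (intro prod_labels) auto
      then show "monom 1 (x_degree (S, u, m)) = (\<Prod>K\<in>components S. m K)"
        by (simp only: label_x_power x_degree_def prod.case)
    qed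
    also have "\<dots> = (\<Prod>K\<in>components S. \<Sum>l\<in>{1, label_x}. l)"
      by (rule prod_sum_PiE[symmetric]) auto
    also have "\<dots> = [:1, 1:] ^ num_components S"
      by (simp add: num_components_def one_pCons)
    finally show ?thesis .
  qed
  have "(\<Sum>s\<in>enhanced_states. monom ((- 1) ^ hom_degree s :: int) (x_degree s)) =
      (\<Sum>(S, u, m)\<in>(SIGMA S:states. (nodal_sites S \<rightarrow>\<^sub>E {0, 1}) \<times> (components S \<rightarrow>\<^sub>E {1, label_x})).
        smult ((- 1) ^ num_nodal S) (monom 1 (x_degree (S, u, m))))"
    by (rule sum.cong) (auto simp: enhanced_states_def hom_degree_def smult_monom)
  also have "\<dots> = (\<Sum>S\<in>states. \<Sum>(u, m)\<in>(nodal_sites S \<rightarrow>\<^sub>E {0, 1}) \<times> (components S \<rightarrow>\<^sub>E {1, label_x}).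
        smult ((- 1) ^ num_nodal S) (monom 1 (x_degree (S, u, m))))"
    by (rule sum.Sigma[symmetric])
       (auto intro!: finite_states finite_cartesian_product finite_PiE finite_nodal_sites)
  also have "\<dots> = (\<Sum>S\<in>states. \<Sum>u\<in>nodal_sites S \<rightarrow>\<^sub>E {0, 1::nat}.
        smult ((- 1) ^ num_nodal S) ([:1, 1:] ^ num_components S))"
    by (simp only: sum.cartesian_product[symmetric] labels smult_sum_right[symmetric])
  also have "\<dots> = (\<Sum>S\<in>states. smult ((- 1) ^ num_nodal S * 2 ^ num_nodal S) ([:1, 1:] ^ num_components S))"
    by (intro sum.cong refl)
       (simp add: card_PiE[OF finite_nodal_sites] num_nodal_def of_nat_poly mult.commute)
  also have "\<dots> = (\<Sum>S\<in>states. pcompose (monom ((- 1) ^ num_nodal S * 2 ^ num_nodal S) (num_components S)) [:1, 1:])"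
    by (intro sum.cong refl) (simp add: pcompose_monom)
  also have "\<dots> = pcompose PK [:1, 1:]"
    unfolding PK_def by (rule pcompose_sum[symmetric])
  finally show ?thesis by (rule sym)
qed

end

theorem mainTheorem6:
  fixes G :: "('a, 'b) pre_digraph" and arev :: "'b \<Rightarrow> 'b"
    and M :: "'b set set" and par :: "'b \<Rightarrow> 'b" and r :: "'b set rel"
  assumes "matched_trivalent_graph G arev M par r"
  shows "pcompose (matched_trivalent_graph.PK G arev M par) [:1, 1:] =
    Sum_any (\<lambda>j. monom (matched_trivalent_graph.euler_char G arev M par r j) j)"
proof -
  interpret matched_trivalent_graph G arev M par r by fact
  show ?thesis by (simp only: PK_enhanced_states euler_polynomial)
qed

end
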